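(* (Random scaling.) Let $Z_1$ satisfy the marginal limit condition with parameters $(\mu,h,\ell,Y_1)$ (defined in the context). Set $Z_1^{\mathrm{rs}}=Z_1$, $Y_1^{\mathrm{rs}}=Y_1$, and for $t>0$ define $$Z_2^{\mathrm{rs}}(t)=\frac1t\int_0^t\Big(Z_1(s)-\frac stZ_1(t)\Big)^2ds,\qquad Z_2^{*,\mathrm{rs}}(t)=\frac1t\int_0^tZ_2^{\mathrm{rs}}(u)\,du,$$ $$Y_2^{\mathrm{rs}}(t)=\frac1t\int_0^t\Big(Y_1(s)-\frac stY_1(t)\Big)^2ds,\qquad Y_2^{*,\mathrm{rs}}(t)=\frac1t\int_0^tY_2^{\mathrm{rs}}(u)\,du,$$ all four processes being defined to be zero at time zero. Suppose that $\mathbb P(Y_2^{*,\mathrm{rs}}(1)>0)=1$. Then, as $\varepsilon\to0^+$, $$\Big(\varepsilon^h\ell(\varepsilon^{-1})\big(Z_1^{\mathrm{rs}}(\tfrac{\cdot}{\varepsilon})-\tfrac{\cdot}{\varepsilon}\mu\big),\ \varepsilon^h\ell(\varepsilon^{-1})\sqrt{Z_2^{*,\mathrm{rs}}(\tfrac{\cdot}{\varepsilon})}\Big)\Rightarrow\Big(Y_1^{\mathrm{rs}}(\cdot),\sqrt{Y_2^{*,\mathrm{rs}}(\cdot)}\Big)\quad\text{weakly in }\mathrm{WM}_2,$$ the process $Y_2^{*,\mathrm{rs}}$ is continuous, and the pair $(Z_1^{\mathrm{rs}},Z_2^{*,\mathrm{rs}})$ satisfies the functional limit condition with parameters $(\m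u,h,\ell,Y_1^{\mathrm{rs}},Y_2^{*,\mathrm{rs}})$.
   Context: Topologies. Write $\mathbb D=D([0,\infty),\mathbb R)$ and $\mathbb D_+=D([0,\infty),\mathbb R_+)$ for càdlàg paths. For a càdlàg $x$ on $[0,T]$, its completed graph is $\Gamma_x=\{(t,z): t\in[0,T],\ z$ between $x(t-)$ and $x(t)$ inclusive$\}$, with $x(0-):=x(0)$. The $M_2$ topology on $D([0,T],\mathbb R)$ is induced by the Hausdorff distance between completed graphs. Convergence on $[0,\infty)$ means convergence of the restrictions to $[0,T]$ for every continuity point $T$ of the limit. $\mathrm{WM}_2$ denotes the product of the univariate $M_2$ topologies over the two coordinates. Quasi-left-continuity. A càdlàg process $Y$ is quasi-left-continuous with respect to a filtration if $\mathbb P(\Delta Y(\tau)=0)=1$ for every finite predictable stopping time $\tau$ of that filtration. Augmented natural filtration means the usual augmentation of the natural filtration. Marginal limit condition with parameters $(\mu,h,\ell,Y_1)$. $Z_1$ has sample paths in $\mathbb D$ with $Z_1(0)=0$ a.s.; $\mu\in\mathbb R$; $0<h<1$; $\ell$ is an eventually positive function slowly varying at infinity; $Y_1\in\mathbb D$ is a process such that $\varepsilon^h\ell(\varepsilon^{-1})(Z_1(\tfrac{\cdot}{\varepsilon})-\tfrac{\cdot}{\varepsilon}\mu)\Rightarrow Y_1(\cdot)$ weakly in $M_2$ as $\varepsilon\to0^+$; $(Z_1(t)-\mu t)/t\to0$ a.s. as $t\to\infty$; $Y_1(a\,\cdot)\overset d=a^hY_1(\cdot)$ for every $a>0$; and $Y_1$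 is quasi-left-continuous with respect to its augmented natural filtration. Functional limit condition with parameters $(\mu,h,\ell,Y_1,Y_2)$, for a pair $(Z_1,Z_2)$. $Z_1,Z_2$ are processes with sample paths in $\mathbb D$ and $\mathbb D_+$, $Z_1(0)=0$ a.s.; $\mu,h\in\mathbb R$; $\ell$ is an eventually positive function slowly varying at infinity; $Y_1\in\mathbb D$, $Y_2\in\mathbb D_+$ are processes such that, as $\varepsilon\to0^+$, $$\Big(\varepsilon^h\ell(\varepsilon^{-1})\big(Z_1(\tfrac{\cdot}{\varepsilon})-\tfrac{\cdot}{\varepsilon}\mu\big),\ \varepsilon^h\ell(\varepsilon^{-1})\sqrt{Z_2(\tfrac{\cdot}{\varepsilon})}\Big)\Rightarrow\big(Y_1(\cdot),\sqrt{Y_2(\cdot)}\big)\quad\text{weakly in }\mathrm{WM}_2.$$ Moreover: (a) $0<h<1$; (b) as $t\to\infty$, $(Z_1(t)-\mu t)/t\to0$ and $Z_2(t)/t^2\to0$ a.s.; (c) for every $a>0$, $(Y_1(a\,\cdot),Y_2(a\,\cdot))\overset d=(a^hY_1(\cdot),a^{2h}Y_2(\cdot))$; (d) $Y_1$ is quasi-left-continuous with respect to the augmented natural filtration of $(Y_1,Y_2)$; (e) almost surely $Y_2(t)>0$ for every $t>0$, and $Y_2$ has no negative jumps. *)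

theory Defs
  imports "HOL-Probability.Probability"
begin

section \<open>Cadlag paths and the M2 topology\<close>

text \<open>
  Paths on the half-line are functions on the reals of which only the values at
  nonnegative times matter: every notion below ignores negative times, so that two functions
  agreeing at nonnegative times are topologically indistinguishable points.
\<close>

definition cadlag_paths :: "(real \<Rightarrow> real) set" where
  "cadlag_paths = {x. (\<forall>t\<ge>0. (x \<longlongrightarrow> x t) (at_right t)) \<and> (\<forall>t>0. \<exists>l. (x \<longlongrightarrow> l) (at_left t))}"

definition nonneg_cadlag_paths :: "(real \<Rightarrow> real) set" where
  "nonneg_cadlag_paths = {x \<in> cadlag_paths. \<forall>t\<ge>0. 0 \<le> x t}"

definition left_limit :: "(real \<Rightarrow> real) \<Rightarrow> real \<Rightarrow> real" where
  "left_limit x t = (if t \<le> 0 then x 0 else Lim (at_left t) x)"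

definition jump :: "(real \<Rightarrow> real) \<Rightarrow> real \<Rightarrow> real" where
  "jump x t = x t - left_limit x t"

definition completed_graph :: "real \<Rightarrow> (real \<Rightarrow> real) \<Rightarrow> (real \<times> real) set" where
  "completed_graph T x = {(t, z). t \<in> {0..T} \<and> z \<in> closed_segment (left_limit x t) (x t)}"

definition hausdorff_distance :: "'a::metric_space set \<Rightarrow> 'a set \<Rightarrow> real" where
  "hausdorff_distance A B = max (SUP a\<in>A. infdist a B) (SUP b\<in>B. infdist b A)"

definition m2_dist :: "real \<Rightarrow> (real \<Rightarrow> real) \<Rightarrow> (real \<Rightarrow> real) \<Rightarrow> real" where
  "m2_dist T x y = hausdorff_distance (completed_graph T x) (completed_graph T y)"

definition m2_converges :: "(nat \<Rightarrow> real \<Rightarrow> real) \<Rightarrow> (real \<Rightarrow> real) \<Rightarrow> bool" where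
  "m2_converges X x \<longleftrightarrow> (\<forall>T>0. left_limit x T = x T \<longrightarrow> (\<lambda>n. m2_dist T (X n) x) \<longlonglongrightarrow> 0)"

text \<open>
  The M2 topology on the half-line is specified through its convergent sequences. Since it is
  (pseudo)metrizable, its open sets are the sequentially open ones.
\<close>

definition m2_open :: "(real \<Rightarrow> real) set \<Rightarrow> bool" where
  "m2_open U \<longleftrightarrow> U \<subseteq> cadlag_paths \<and>
     (\<forall>x\<in>U. \<forall>X. (\<forall>n. X n \<in> cadlag_paths) \<longrightarrow> m2_converges X x \<longrightarrow> (\<forall>\<^sub>F n in sequentially. X n \<in> U))"

definition m2_topology :: "(real \<Rightarrow> real) topology" where
  "m2_topology = topology m2_open"

lemma istopology_m2_open: "istopology m2_open"
  unfolding istopology_def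
proof (intro conjI allI impI)
  fix S T assume "m2_open S" "m2_open T"
  then show "m2_open (S \<inter> T)"
    unfolding m2_open_def by (auto simp: eventually_conj_iff)
next
  fix K assume K: "\<forall>U\<in>K. m2_open U"
  show "m2_open (\<Union>K)"
    unfolding m2_open_def
  proof (intro conjI ballI allI impI)
    show "\<Union>K \<subseteq> cadlag_paths"
      using K by (auto simp: m2_open_def)
  next
    fix x X assume x: "x \<in> \<Union>K" and X: "\<forall>n. X n \<in> cadlag_paths" "m2_converges X x"
    then obtain U where U: "U \<in> K" "x \<in> U" by blast
    with K X have "\<forall>\<^sub>F n in sequentially. X n \<in> U"
      by (auto simp: m2_open_def)
    then show "\<forall>\<^sub>F n in sequentially. X n \<in> \<Union>K"
      by (rule eventually_mono) (use U in blast)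
  qed
qed

lemma openin_m2_topology: "openin m2_topology U \<longleftrightarrow> m2_open U"
  by (simp add: m2_topology_def istopology_m2_open)

lemma topspace_m2_topology: "topspace m2_topology = cadlag_paths"
proof -
  have "m2_open cadlag_paths" by (auto simp: m2_open_def)
  moreover have "U \<subseteq> cadlag_paths" if "m2_open U" for U
    using that by (simp add: m2_open_def)
  ultimately show ?thesis
    unfolding topspace_def openin_m2_topology by blast
qed

definition wm2_topology :: "((real \<Rightarrow> real) \<times> (real \<Rightarrow> real)) topology" where
  "wm2_topology = prod_topology m2_topology m2_topology"


section \<open>Processes and their laws\<close>

text \<open>
  Sample path properties hold almost surely, and measurability and expectations refer to the
  completed probability space, so that changing a process on a null set is harmless.
\<close>

definition process :: "'a measure \<Rightarrow> (real \<Rightarrow> 'a \<Rightarrow> real) \<Rightarrow> bool" where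
  "process M Z \<longleftrightarrow> (\<forall>t\<ge>0. Z t \<in> borel_measurable (completion M))"

definition sample_paths_in :: "'a measure \<Rightarrow> (real \<Rightarrow> real) set \<Rightarrow> (real \<Rightarrow> 'a \<Rightarrow> real) \<Rightarrow> bool" where
  "sample_paths_in M S Z \<longleftrightarrow> (AE \<omega> in M. (\<lambda>t. Z t \<omega>) \<in> S)"

text \<open>
  Equality in distribution is equality of the laws on the sigma-algebra generated by the
  coordinates; on cadlag paths this is also the Borel sigma-algebra of M2.
\<close>

definition path_law :: "'a measure \<Rightarrow> (real \<Rightarrow> 'a \<Rightarrow> 'b::topological_space) \<Rightarrow> (real \<Rightarrow> 'b) measure" where
  "path_law M X = distr (completion M) (Pi\<^sub>M {0..} (\<lambda>_. borel)) (\<lambda>\<omega>. \<lambda>t\<in>{0..}. X t \<omega>)"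

definition converges_weakly ::
  "'s topology \<Rightarrow> 'a measure \<Rightarrow> ('i \<Rightarrow> 'a \<Rightarrow> 's) \<Rightarrow> 'b measure \<Rightarrow> ('b \<Rightarrow> 's) \<Rightarrow> 'i filter \<Rightarrow> bool" where
  "converges_weakly T M X N Y F \<longleftrightarrow>
     (\<forall>f. continuous_map T euclideanreal f \<longrightarrow> bounded (f ` topspace T) \<longrightarrow>
        ((\<lambda>i. \<integral>\<omega>. f (X i \<omega>) \<partial>completion M) \<longlongrightarrow> (\<integral>\<omega>. f (Y \<omega>) \<partial>completion N)) F)"


section \<open>Quasi-left-continuity\<close>

text \<open>
  The usual augmentation: adjoin all subsets of null sets and take right limits of the filtration.
\<close>

definition augmented_filtration ::
  "'a measure \<Rightarrow> (real \<Rightarrow> 'a \<Rightarrow> real) set \<Rightarrow> real \<Rightarrow> 'a measure" where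
  "augmented_filtration N \<Y> t = sigma (space N)
     (\<Inter>s\<in>{t<..}. sigma_sets (space N)
        ({Y u -` B \<inter> space N | Y u B. Y \<in> \<Y> \<and> 0 \<le> u \<and> u \<le> s \<and> B \<in> sets borel}
          \<union> null_sets (completion N)))"

text \<open>
  Predictable times are those announced by a sequence of stopping times. Only finite ones are
  needed, hence the real values.
\<close>

definition finite_predictable_time ::
  "'a measure \<Rightarrow> (real \<Rightarrow> 'a measure) \<Rightarrow> ('a \<Rightarrow> real) \<Rightarrow> bool" where
  "finite_predictable_time N F \<tau> \<longleftrightarrow>
     stopping_time F \<tau> \<and> (\<forall>\<omega>\<in>space N. 0 \<le> \<tau> \<omega>) \<and>
     (\<exists>\<sigma> :: nat \<Rightarrow> 'a \<Rightarrow> real.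
        (\<forall>n. stopping_time F (\<sigma> n) \<and> (\<forall>\<omega>\<in>space N. 0 \<le> \<sigma> n \<omega>)) \<and>
        (AE \<omega> in N. incseq (\<lambda>n. \<sigma> n \<omega>) \<and> (\<lambda>n. \<sigma> n \<omega>) \<longlonglongrightarrow> \<tau> \<omega> \<and>
           (0 < \<tau> \<omega> \<longrightarrow> (\<forall>n. \<sigma> n \<omega> < \<tau> \<omega>))))"

definition quasi_left_continuous ::
  "'a measure \<Rightarrow> (real \<Rightarrow> 'a measure) \<Rightarrow> (real \<Rightarrow> 'a \<Rightarrow> real) \<Rightarrow> bool" where
  "quasi_left_continuous N F Y \<longleftrightarrow>
     (\<forall>\<tau>. finite_predictable_time N F \<tau> \<longrightarrow> (AE \<omega> in N. jump (\<lambda>t. Y t \<omega>) (\<tau> \<omega>) = 0))"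


section \<open>The limit conditions\<close>

definition slowly_varying :: "(real \<Rightarrow> real) \<Rightarrow> bool" where
  "slowly_varying l \<longleftrightarrow> (\<forall>c>0. ((\<lambda>x. l (c * x) / l x) \<longlongrightarrow> 1) at_top)"

definition rescaled_centred ::
  "real \<Rightarrow> real \<Rightarrow> (real \<Rightarrow> real) \<Rightarrow> real \<Rightarrow> (real \<Rightarrow> 'a \<Rightarrow> real) \<Rightarrow> 'a \<Rightarrow> real \<Rightarrow> real" where
  "rescaled_centred \<mu> h l \<epsilon> Z \<omega> = (\<lambda>t. \<epsilon> powr h * l (1 / \<epsilon>) * (Z (t / \<epsilon>) \<omega> - t / \<epsilon> * \<mu>))"

definition rescaled_sqrt ::
  "real \<Rightarrow> (real \<Rightarrow> real) \<Rightarrow> real \<Rightarrow> (real \<Rightarrow> 'a \<Rightarrow> real) \<Rightarrow> 'a \<Rightarrow> real \<Rightarrow> real" where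
  "rescaled_sqrt h l \<epsilon> Z \<omega> = (\<lambda>t. \<epsilon> powr h * l (1 / \<epsilon>) * sqrt (Z (t / \<epsilon>) \<omega>))"

text \<open>
  The processes \<open>Z\<close> and the limit processes \<open>Y\<close> may live on different probability spaces
  \<open>M\<close> and \<open>N\<close>.
\<close>

definition marginal_limit_condition ::
  "'a measure \<Rightarrow> (real \<Rightarrow> 'a \<Rightarrow> real) \<Rightarrow> real \<Rightarrow> real \<Rightarrow> (real \<Rightarrow> real) \<Rightarrow>
   'b measure \<Rightarrow> (real \<Rightarrow> 'b \<Rightarrow> real) \<Rightarrow> bool" where
  "marginal_limit_condition M Z1 \<mu> h l N Y1 \<longleftrightarrow>
     process M Z1 \<and> sample_paths_in M cadlag_paths Z1 \<and> (AE \<omega> in M. Z1 0 \<omega> = 0) \<and>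
     0 < h \<and> h < 1 \<and>
     (\<forall>\<^sub>F x in at_top. 0 < l x) \<and> slowly_varying l \<and>
     process N Y1 \<and> sample_paths_in N cadlag_paths Y1 \<and>
     converges_weakly m2_topology
       M (\<lambda>\<epsilon>. rescaled_centred \<mu> h l \<epsilon> Z1)
       N (\<lambda>\<omega> t. Y1 t \<omega>) (at_right 0) \<and>
     (AE \<omega> in M. ((\<lambda>t. (Z1 t \<omega> - \<mu> * t) / t) \<longlongrightarrow> 0) at_top) \<and>
     (\<forall>a>0. path_law N (\<lambda>t. Y1 (a * t)) = path_law N (\<lambda>t \<omega>. a powr h * Y1 t \<omega>)) \<and>
     quasi_left_continuous N (augmented_filtration N {Y1}) Y1"

definition functional_weak_limit ::
  "'a measure \<Rightarrow> (real \<Rightarrow> 'a \<Rightarrow> real) \<Rightarrow> (real \<Rightarrow> 'a \<Rightarrow> real) \<Rightarrow> real \<Rightarrow> real \<Rightarrow> (real \<Rightarrow> real) \<Rightarrow>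
   'b measure \<Rightarrow> (real \<Rightarrow> 'b \<Rightarrow> real) \<Rightarrow> (real \<Rightarrow> 'b \<Rightarrow> real) \<Rightarrow> bool" where
  "functional_weak_limit M Z1 Z2 \<mu> h l N Y1 Y2 \<longleftrightarrow>
     converges_weakly wm2_topology
       M (\<lambda>\<epsilon> \<omega>. (rescaled_centred \<mu> h l \<epsilon> Z1 \<omega>, rescaled_sqrt h l \<epsilon> Z2 \<omega>))
       N (\<lambda>\<omega>. (\<lambda>t. Y1 t \<omega>, \<lambda>t. sqrt (Y2 t \<omega>))) (at_right 0)"

definition functional_limit_condition ::
  "'a measure \<Rightarrow> (real \<Rightarrow> 'a \<Rightarrow> real) \<Rightarrow> (real \<Rightarrow> 'a \<Rightarrow> real) \<Rightarrow> real \<Rightarrow> real \<Rightarrow> (real \<Rightarrow> real) \<Rightarrow>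
   'b measure \<Rightarrow> (real \<Rightarrow> 'b \<Rightarrow> real) \<Rightarrow> (real \<Rightarrow> 'b \<Rightarrow> real) \<Rightarrow> bool" where
  "functional_limit_condition M Z1 Z2 \<mu> h l N Y1 Y2 \<longleftrightarrow>
     process M Z1 \<and> sample_paths_in M cadlag_paths Z1 \<and> (AE \<omega> in M. Z1 0 \<omega> = 0) \<and>
     process M Z2 \<and> sample_paths_in M nonneg_cadlag_paths Z2 \<and>
     (\<forall>\<^sub>F x in at_top. 0 < l x) \<and> slowly_varying l \<and>
     process N Y1 \<and> sample_paths_in N cadlag_paths Y1 \<and>
     process N Y2 \<and> sample_paths_in N nonneg_cadlag_paths Y2 \<and>
     functional_weak_limit M Z1 Z2 \<mu> h l N Y1 Y2 \<and>
     0 < h \<and> h < 1 \<and>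
     (AE \<omega> in M. ((\<lambda>t. (Z1 t \<omega> - \<mu> * t) / t) \<longlongrightarrow> 0) at_top) \<and>
     (AE \<omega> in M. ((\<lambda>t. Z2 t \<omega> / t\<^sup>2) \<longlongrightarrow> 0) at_top) \<and>
     (\<forall>a>0. path_law N (\<lambda>t \<omega>. (Y1 (a * t) \<omega>, Y2 (a * t) \<omega>)) =
             path_law N (\<lambda>t \<omega>. (a powr h * Y1 t \<omega>, a powr (2 * h) * Y2 t \<omega>))) \<and>
     quasi_left_continuous N (augmented_filtration N {Y1, Y2}) Y1 \<and>
     (AE \<omega> in N. \<forall>t>0. 0 < Y2 t \<omega>) \<and>
     (AE \<omega> in N. \<forall>t>0. 0 \<le> jump (\<lambda>s. Y2 s \<omega>) t)"


section \<open>Random scaling\<close>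

definition random_scaling :: "(real \<Rightarrow> 'a \<Rightarrow> real) \<Rightarrow> real \<Rightarrow> 'a \<Rightarrow> real" where
  "random_scaling Z t \<omega> =
     (if t \<le> 0 then 0 else 1 / t * (LBINT s:{0..t}. (Z s \<omega> - s / t * Z t \<omega>)\<^sup>2))"

definition averaged_random_scaling :: "(real \<Rightarrow> 'a \<Rightarrow> real) \<Rightarrow> real \<Rightarrow> 'a \<Rightarrow> real" where
  "averaged_random_scaling Z t \<omega> =
     (if t \<le> 0 then 0 else 1 / t * (LBINT u:{0..t}. random_scaling Z u \<omega>))"

end

theory Submission
  imports Defs
begin

text \<open>
  For a path \<open>x\<close> that starts at zero, averaged random scaling at \<open>t\<close> equals the integral over
  \<open>u\<close> and \<open>v\<close> in the unit interval of the square of \<open>x (t * u * v) - v * x (t * u)\<close>, called the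
  mean bridge energy below. In this form it is homogeneous of degree two, commutes with time scaling,
  ignores linear trends, and makes sense at time zero without a division.

  The point is that the square root of this functional is continuous from M2 to M2
  (\<open>continuous_map_root_energy\<close>). If \<open>X n\<close> converges to \<open>x\<close> in M2, then \<open>X n\<close> is locally bounded
  and \<open>X n (s n)\<close> tends to \<open>x s\<close> whenever \<open>s n\<close> tends to a continuity time \<open>s\<close> of \<open>x\<close>. All but
  countably many times are of this kind, so by dominated convergence the energies at times \<open>t n\<close>
  converge to the energy at \<open>t\<close> for every convergent sequence of times. On the one hand
  this shows that the energy is continuous in time, and on the other hand, together with that
  continuity, that the convergence is uniform on compact intervals, which is stronger than M2.

  Centring by \<open>\<mu>\<close> does not change the energy, and so the rescaled pair is the image
  of the rescaled first component under the continuous map \<open>\<lambda>x. (x, root_energy x)\<close>. The joint weak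
  limit is therefore the continuous mapping theorem
  (\<open>functional_weak_limit_averaged_random_scaling\<close>). The limit process starts at zero by
  self-similarity (\<open>self_similar_zero_start\<close>).

  The remaining properties rest on the fact that averaged random scaling at time \<open>u\<close> is,
  almost surely, a measurable functional of the path on \<open>{0..u}\<close> in the product space
  (\<open>averaged_random_scaling_eq_functional\<close>). Hence the pair inherits self-similarity from its first
  component, and adjoining the second component does not enlarge the augmented filtration, so
  quasi-left-continuity persists. Positivity at time 1 carries over to each fixed time by
  self-similarity, and to all times at once because \<open>t\<close> times the mean energy up to \<open>t\<close> is the
  integral of a nonnegative function over \<open>{0..t}\<close>. The growth condition holds because the energy is
  at most four times the squared supremum of the centred path.
\<close>

section \<open>Regularity of cadlag paths\<close>

lemma cadlag_tendsto_right:
  "x \<in> cadlag_paths \<Longrightarrow> 0 \<le> t \<Longrightarrow> (x \<longlongrightarrow> x t) (at_right t)"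
  by (simp add: cadlag_paths_def)

lemma cadlag_tendsto_left_limit:
  assumes "x \<in> cadlag_paths" "0 < t"
  shows "(x \<longlongrightarrow> left_limit x t) (at_left t)"
proof -
  obtain k where "(x \<longlongrightarrow> k) (at_left t)"
    using assms by (auto simp: cadlag_paths_def)
  moreover from this have "left_limit x t = k"
    using assms by (simp add: left_limit_def tendsto_Lim)
  ultimately show ?thesis by simp
qed

lemma cadlag_near_right:
  assumes "x \<in> cadlag_paths" "0 \<le> t" "0 < e"
  obtains d where "0 < d" "\<And>s. t \<le> s \<Longrightarrow> s < t + d \<Longrightarrow> \<bar>x s - x t\<bar> < e"
proof -
  have "\<forall>\<^sub>F s in at_right t. dist (x s) (x t) < e"
    using tendstoD[OF cadlag_tendsto_right[OF assms(1,2)] assms(3)] .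
  then obtain b where b: "b > t" "\<And>s. t < s \<Longrightarrow> s < b \<Longrightarrow> \<bar>x s - x t\<bar> < e"
    unfolding eventually_at_right_field dist_real_def by blast
  have "\<bar>x s - x t\<bar> < e" if "t \<le> s" "s < t + (b - t)" for s
    using b(2)[of s] that assms(3) by (cases "s = t") auto
  then show thesis using b(1) that[of "b - t"] by simp
qed

lemma cadlag_near_left:
  assumes x: "x \<in> cadlag_paths" and t: "0 \<le> t" and e: "0 < e"
  obtains d where "0 < d"
    "\<And>s. 0 \<le> s \<Longrightarrow> t - d < s \<Longrightarrow> s < t \<Longrightarrow> \<bar>x s - left_limit x t\<bar> < e"
proof (cases "t = 0")
  case True
  then show thesis using that[of 1] by simp
next
  case False
  then have "\<forall>\<^sub>F s in at_left t. dist (x s) (left_limit x t) < e"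
    using tendstoD[OF cadlag_tendsto_left_limit[OF x] e] t by simp
  then obtain b where b: "b < t" "\<And>s. b < s \<Longrightarrow> s < t \<Longrightarrow> \<bar>x s - left_limit x t\<bar> < e"
    unfolding eventually_at_left_field dist_real_def by blast
  show thesis
    by (rule that[of "t - b"]) (use b in auto)
qed

lemma left_limit_close:
  assumes x: "x \<in> cadlag_paths" and t: "0 \<le> t" "a < t"
    and close: "\<And>s. 0 \<le> s \<Longrightarrow> a < s \<Longrightarrow> s \<le> t \<Longrightarrow> \<bar>x s - c\<bar> \<le> e"
  shows "\<bar>left_limit x t - c\<bar> \<le> e"
proof (cases "t = 0")
  case True
  then show ?thesis using close[of 0] t by (simp add: left_limit_def)
next
  case False
  then have t0: "0 < t" using t by simp
  have "((\<lambda>s. \<bar>x s - c\<bar>) \<longlongrightarrow> \<bar>left_limit x t - c\<bar>) (at_left t)"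
    by (intro tendsto_intros cadlag_tendsto_left_limit x t0)
  moreover have "\<forall>\<^sub>F s in at_left t. \<bar>x s - c\<bar> \<le> e"
    unfolding eventually_at_left_field
    using close t0 t(2) by (intro exI[of _ "max a 0"]) auto
  ultimately show ?thesis
    by (rule tendsto_upperbound) simp
qed

text \<open>
  Boundedness on a compact interval and scarcity of large jumps are both local by the existence
  of one-sided limits, hence global by bisection.
\<close>

lemma cadlag_bounded:
  assumes x: "x \<in> cadlag_paths"
  obtains K where "0 \<le> K" "\<And>s. 0 \<le> s \<Longrightarrow> s \<le> T \<Longrightarrow> \<bar>x s\<bar> \<le> K"
proof -
  define P where "P a b \<longleftrightarrow> (\<exists>K. \<forall>s. 0 \<le> s \<and> a \<le> s \<and> s \<le> b \<longrightarrow> \<bar>x s\<bar> \<le> K)" for a b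
  have "P 0 (max 0 T)"
  proof (rule Bolzano)
    show "0 \<le> max 0 T" by simp
  next
    fix a b c assume "P a b" "P b c"
    then obtain K L where K: "\<And>s. 0 \<le> s \<Longrightarrow> a \<le> s \<Longrightarrow> s \<le> b \<Longrightarrow> \<bar>x s\<bar> \<le> K"
      and L: "\<And>s. 0 \<le> s \<Longrightarrow> b \<le> s \<Longrightarrow> s \<le> c \<Longrightarrow> \<bar>x s\<bar> \<le> L"
      unfolding P_def by blast
    have "\<bar>x s\<bar> \<le> max K L" if "0 \<le> s" "a \<le> s" "s \<le> c" for s
      using K[of s] L[of s] that by (cases "s \<le> b") auto
    then show "P a c" unfolding P_def by blast
  next
    fix t assume t: "0 \<le> t" "t \<le> max 0 T"
    obtain d1 where d1: "0 < d1" "\<And>s. t \<le> s \<Longrightarrow> s < t + d1 \<Longrightarrow> \<bar>x s - x t\<bar> < 1"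
      by (rule cadlag_near_right[OF x t(1), of 1]) (simp, blast)
    obtain d2 where d2: "0 < d2"
      "\<And>s. 0 \<le> s \<Longrightarrow> t - d2 < s \<Longrightarrow> s < t \<Longrightarrow> \<bar>x s - left_limit x t\<bar> < 1"
      by (rule cadlag_near_left[OF x t(1), of 1]) (simp, blast)
    show "\<exists>d>0. \<forall>a b. a \<le> t \<and> t \<le> b \<and> b - a < d \<longrightarrow> P a b"
    proof (intro exI[of _ "min d1 d2"] conjI allI impI)
      show "0 < min d1 d2" using d1 d2 by simp
    next
      fix a b assume ab: "a \<le> t \<and> t \<le> b \<and> b - a < min d1 d2"
      have "\<bar>x s\<bar> \<le> max \<bar>x t\<bar> \<bar>left_limit x t\<bar> + 1" if s: "0 \<le> s" "a \<le> s" "s \<le> b" for s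
      proof (cases "t \<le> s")
        case True
        then have "\<bar>x s - x t\<bar> < 1" using ab s by (intro d1(2)) auto
        then show ?thesis by linarith
      next
        case False
        then have "\<bar>x s - left_limit x t\<bar> < 1" using ab s by (intro d2(2)) auto
        then show ?thesis by linarith
      qed
      then show "P a b" unfolding P_def by blast
    qed
  qed
  then obtain K where "\<And>s. 0 \<le> s \<Longrightarrow> s \<le> max 0 T \<Longrightarrow> \<bar>x s\<bar> \<le> K"
    unfolding P_def by blast
  then have "\<And>s. 0 \<le> s \<Longrightarrow> s \<le> T \<Longrightarrow> \<bar>x s\<bar> \<le> max 0 K"
    by (simp add: le_max_iff_disj)
  then show thesis using that[of "max 0 K"] by simp
qed

lemma finite_large_jumps:
  assumes x: "x \<in> cadlag_paths" and e: "0 < e"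
  shows "finite {t. 0 \<le> t \<and> t \<le> T \<and> e < \<bar>jump x t\<bar>}"
proof -
  define P where "P a b \<longleftrightarrow> finite {t. 0 \<le> t \<and> a \<le> t \<and> t \<le> b \<and> e < \<bar>jump x t\<bar>}" for a b
  have "P 0 (max 0 T)"
  proof (rule Bolzano)
    show "0 \<le> max 0 T" by simp
  next
    fix a b c assume "P a b" "P b c" "a \<le> b" "b \<le> c"
    moreover have "{t. 0 \<le> t \<and> a \<le> t \<and> t \<le> c \<and> e < \<bar>jump x t\<bar>} \<subseteq>
        {t. 0 \<le> t \<and> a \<le> t \<and> t \<le> b \<and> e < \<bar>jump x t\<bar>} \<union> {t. 0 \<le> t \<and> b \<le> t \<and> t \<le> c \<and> e < \<bar>jump x t\<bar>}"
      by auto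
    ultimately show "P a c" unfolding P_def
      by (meson finite_UnI finite_subset)
  next
    fix t assume t: "0 \<le> t" "t \<le> max 0 T"
    have e2: "0 < e / 2" using e by simp
    obtain d1 where d1: "0 < d1" "\<And>s. t \<le> s \<Longrightarrow> s < t + d1 \<Longrightarrow> \<bar>x s - x t\<bar> < e / 2"
      by (rule cadlag_near_right[OF x t(1) e2]) blast
    obtain d2 where d2: "0 < d2"
      "\<And>s. 0 \<le> s \<Longrightarrow> t - d2 < s \<Longrightarrow> s < t \<Longrightarrow> \<bar>x s - left_limit x t\<bar> < e / 2"
      by (rule cadlag_near_left[OF x t(1) e2]) blast
    show "\<exists>d>0. \<forall>a b. a \<le> t \<and> t \<le> b \<and> b - a < d \<longrightarrow> P a b"
    proof (intro exI[of _ "min d1 d2"] conjI allI impI)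
      show "0 < min d1 d2" using d1 d2 by simp
    next
      fix a b assume ab: "a \<le> t \<and> t \<le> b \<and> b - a < min d1 d2"
      have "\<bar>jump x s\<bar> \<le> e" if s: "0 \<le> s" "a \<le> s" "s \<le> b" "s \<noteq> t" for s
      proof (cases "t < s")
        case True
        then have "\<bar>x s - x t\<bar> < e / 2" using ab s by (intro d1(2)) auto
        moreover have "\<bar>left_limit x s - x t\<bar> \<le> e / 2"
          using True ab s by (intro left_limit_close[OF x s(1)] less_imp_le[OF d1(2)]) auto
        ultimately show ?thesis unfolding jump_def by linarith
      next
        case False
        then have "\<bar>x s - left_limit x t\<bar> < e / 2" using ab s by (intro d2(2)) auto
        moreover have "\<bar>left_limit x s - left_limit x t\<bar> \<le> e / 2"
          using False ab s by (intro left_limit_close[OF x s(1), of "t - d2"] less_imp_le[OF d2(2)]) auto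
        ultimately show ?thesis unfolding jump_def by linarith
      qed
      then have "{s. 0 \<le> s \<and> a \<le> s \<and> s \<le> b \<and> e < \<bar>jump x s\<bar>} \<subseteq> {t}"
        by (auto simp: not_le[symmetric])
      then show "P a b" unfolding P_def using finite_subset by blast
    qed
  qed
  then show ?thesis unfolding P_def by (rule finite_subset[rotated]) auto
qed

lemma countable_jumps:
  assumes x: "x \<in> cadlag_paths"
  shows "countable {t. 0 \<le> t \<and> jump x t \<noteq> 0}"
proof (rule countable_subset)
  show "{t. 0 \<le> t \<and> jump x t \<noteq> 0} \<subseteq>
      (\<Union>n m. {t. 0 \<le> t \<and> t \<le> real m \<and> 1 / real (Suc n) < \<bar>jump x t\<bar>})"
  proof
    fix t assume t: "t \<in> {t. 0 \<le> t \<and> jump x t \<noteq> 0}"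
    then obtain n where "1 / real (Suc n) < \<bar>jump x t\<bar>"
      using nat_approx_posE[of "\<bar>jump x t\<bar>"] by auto
    moreover obtain m where "t \<le> real m" using real_arch_simple by blast
    ultimately show "t \<in> (\<Union>n m. {t. 0 \<le> t \<and> t \<le> real m \<and> 1 / real (Suc n) < \<bar>jump x t\<bar>})"
      using t by blast
  qed
  show "countable (\<Union>n m. {t. 0 \<le> t \<and> t \<le> real m \<and> 1 / real (Suc n) < \<bar>jump x t\<bar>})"
  proof (intro countable_UN)
    show "countable {t. 0 \<le> t \<and> t \<le> real m \<and> 1 / real (Suc n) < \<bar>jump x t\<bar>}" for n m
      by (rule countable_finite[OF finite_large_jumps[OF x]]) simp
  qed simp_all
qed

lemma jump_zero_time [simp]: "jump x 0 = 0"
  by (simp add: jump_def left_limit_def)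

lemma cadlag_near_continuity_time:
  assumes x: "x \<in> cadlag_paths" and t: "0 \<le> t" "jump x t = 0" and e: "0 < e"
  obtains d where "0 < d" "\<And>s. 0 \<le> s \<Longrightarrow> \<bar>s - t\<bar> < d \<Longrightarrow> \<bar>x s - x t\<bar> < e"
proof -
  have left_lim: "left_limit x t = x t" using t(2) by (simp add: jump_def)
  obtain d1 where d1: "0 < d1" "\<And>s. t \<le> s \<Longrightarrow> s < t + d1 \<Longrightarrow> \<bar>x s - x t\<bar> < e"
    by (rule cadlag_near_right[OF x t(1) e]) blast
  obtain d2 where d2: "0 < d2"
    "\<And>s. 0 \<le> s \<Longrightarrow> t - d2 < s \<Longrightarrow> s < t \<Longrightarrow> \<bar>x s - x t\<bar> < e"
    by (rule cadlag_near_left[OF x t(1) e, unfolded left_lim]) blast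
  have "\<bar>x s - x t\<bar> < e" if "0 \<le> s" "\<bar>s - t\<bar> < min d1 d2" for s
    using d1(2)[of s] d2(2)[of s] that by (cases "t \<le> s") auto
  with d1(1) d2(1) show thesis using that[of "min d1 d2"] by auto
qed

text \<open>
  M2 convergence on the half-line gives information only up to continuity times of the limit. As
  jump times are countable, such horizons lie beyond any given time.
\<close>

lemma exists_continuity_time:
  assumes x: "x \<in> cadlag_paths"
  obtains T where "s < T" "0 < T" "jump x T = 0"
proof -
  have "uncountable ({max 0 s<..<max 0 s + 1} - {t. 0 \<le> t \<and> jump x t \<noteq> 0})"
    by (intro uncountable_minus_countable countable_jumps[OF x]) (simp add: uncountable_open_interval)
  then obtain T where "T \<in> {max 0 s<..<max 0 s + 1} - {t. 0 \<le> t \<and> jump x t \<noteq> 0}"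
    by (metis countable_empty ex_in_conv)
  then show thesis using that[of T] by auto
qed

lemma cadlag_measurable:
  assumes x: "x \<in> cadlag_paths"
  shows "(\<lambda>t. x (max 0 t)) \<in> borel_measurable borel"
proof (rule borel_measurable_continuous_countable_exceptions)
  show "countable {t. 0 \<le> t \<and> jump x t \<noteq> 0}" by (rule countable_jumps[OF x])
  show "continuous_on (- {t. 0 \<le> t \<and> jump x t \<noteq> 0}) (\<lambda>t. x (max 0 t))"
    unfolding continuous_on_iff
  proof (intro ballI allI impI)
    fix t e :: real assume t: "t \<in> - {t. 0 \<le> t \<and> jump x t \<noteq> 0}" and e: "0 < e"
    have "jump x (max 0 t) = 0" using t by (cases "0 \<le> t") (auto simp: max_def)
    then obtain d where d: "0 < d" "\<And>s. 0 \<le> s \<Longrightarrow> \<bar>s - max 0 t\<bar> < d \<Longrightarrow> \<bar>x s - x (max 0 t)\<bar> < e"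
      using cadlag_near_continuity_time[OF x _ _ e, of "max 0 t"] by auto
    have "dist (x (max 0 s)) (x (max 0 t)) < e" if "dist s t < d" for s
      unfolding dist_real_def using that by (intro d(2)) (auto simp: dist_real_def max_def)
    then show "\<exists>d>0. \<forall>s\<in>- {t. 0 \<le> t \<and> jump x t \<noteq> 0}.
        dist s t < d \<longrightarrow> dist (x (max 0 s)) (x (max 0 t)) < e"
      using d(1) by blast
  qed
qed

lemma continuous_on_imp_cadlag:
  assumes "continuous_on {0..} x"
  shows "x \<in> cadlag_paths"
proof -
  have *: "(x \<longlongrightarrow> x t) (at t within {0..})" if "0 \<le> t" for t
    using assms that by (simp add: continuous_on_def)
  have "(x \<longlongrightarrow> x t) (at_right t)" if "0 \<le> t" for t
    by (rule tendsto_within_subset[OF *[OF that]]) (use that in auto)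
  moreover have "(x \<longlongrightarrow> x t) (at_left t)" if "0 < t" for t
  proof -
    have "at t within {0..} = at t"
      using that by (intro at_within_interior) (auto simp: interior_real_atLeast)
    then have "(x \<longlongrightarrow> x t) (at t)" using *[of t] that by simp
    then show ?thesis by (rule tendsto_within_subset[of _ _ _ UNIV]) simp
  qed
  ultimately show ?thesis unfolding cadlag_paths_def by blast
qed

lemma continuous_on_imp_jump_zero:
  assumes "continuous_on {0..} x" "0 \<le> t"
  shows "jump x t = 0"
proof -
  have x: "x \<in> cadlag_paths" by (rule continuous_on_imp_cadlag[OF assms(1)])
  have "\<bar>left_limit x t - x t\<bar> \<le> e" if e: "0 < e" for e
  proof -
    have "\<exists>d>0. \<forall>s\<in>{0..}. dist s t < d \<longrightarrow> dist (x s) (x t) < e"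
      using assms(1)[unfolded continuous_on_iff, rule_format, OF _ e, of t] assms(2) by simp
    then obtain d where d: "0 < d" "\<And>s. 0 \<le> s \<Longrightarrow> dist s t < d \<Longrightarrow> dist (x s) (x t) < e"
      by auto
    show ?thesis
    proof (rule left_limit_close[OF x assms(2), of "t - d"])
      fix s assume "0 \<le> s" "t - d < s" "s \<le> t"
      then show "\<bar>x s - x t\<bar> \<le> e" using d(2)[of s] by (auto simp: dist_real_def)
    qed (use d(1) in simp)
  qed
  then have "\<bar>left_limit x t - x t\<bar> \<le> 0" by (rule field_le_epsilon) simp_all
  then show ?thesis by (simp add: jump_def)
qed

section \<open>Convergence of paths in the M2 topology\<close>

text \<open>
  Left limits inherit closed bounds, and a point of the completed graph lies on the segment between
  the left limit and the value, so bounds on the path pass to its completed graph.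
\<close>

lemma graph_point_close:
  assumes x: "x \<in> cadlag_paths" and p: "(r, z) \<in> completed_graph T x" and "a < r"
    and close: "\<And>s. 0 \<le> s \<Longrightarrow> a < s \<Longrightarrow> s \<le> r \<Longrightarrow> \<bar>x s - c\<bar> \<le> e"
  shows "\<bar>z - c\<bar> \<le> e"
proof -
  have r: "0 \<le> r" and z: "z \<in> closed_segment (left_limit x r) (x r)"
    using p by (auto simp: completed_graph_def)
  have "\<bar>left_limit x r - c\<bar> \<le> e"
    by (rule left_limit_close[OF x r assms(3) close])
  moreover have "\<bar>x r - c\<bar> \<le> e"
    using close[of r] r assms(3) by simp
  ultimately have "closed_segment (left_limit x r) (x r) \<subseteq> cball c e"
    by (intro closed_segment_subset) (auto simp: dist_real_def abs_minus_commute)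
  then show ?thesis using z by (auto simp: dist_real_def abs_minus_commute)
qed

lemma graph_point_bounded:
  assumes x: "x \<in> cadlag_paths" and p: "(r, z) \<in> completed_graph T x"
    and K: "\<And>s. 0 \<le> s \<Longrightarrow> s \<le> T \<Longrightarrow> \<bar>x s\<bar> \<le> K"
  shows "\<bar>z\<bar> \<le> K"
  using graph_point_close[OF x p, of "r - 1" 0 K] K p by (auto simp: completed_graph_def)

lemma path_point_in_graph: "0 \<le> t \<Longrightarrow> t \<le> T \<Longrightarrow> (t, x t) \<in> completed_graph T x"
  by (simp add: completed_graph_def)

lemma bounded_completed_graph:
  assumes x: "x \<in> cadlag_paths"
  shows "bounded (completed_graph T x)"
proof -
  obtain K where K: "0 \<le> K" "\<And>s. 0 \<le> s \<Longrightarrow> s \<le> T \<Longrightarrow> \<bar>x s\<bar> \<le> K"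
    using cadlag_bounded[OF x] by blast
  have "completed_graph T x \<subseteq> {0..T} \<times> {-K..K}"
  proof
    fix p assume p: "p \<in> completed_graph T x"
    obtain r z where rz: "p = (r, z)" by (cases p)
    have "\<bar>z\<bar> \<le> K" using graph_point_bounded[OF x p[unfolded rz] K(2)] .
    then show "p \<in> {0..T} \<times> {-K..K}" using p by (auto simp: rz completed_graph_def)
  qed
  then show ?thesis
    by (rule bounded_subset[rotated]) (intro bounded_Times bounded_closed_interval)
qed

text \<open>
  The Hausdorff distance is a supremum in the reals, which bounds its members only because
  completed graphs are bounded.
\<close>

lemma bdd_above_infdist:
  fixes A B :: "'a::metric_space set"
  assumes "bounded A" "B \<noteq> {}"
  shows "bdd_above ((\<lambda>a. infdist a B) ` A)"
proof -
  obtain b where b: "b \<in> B" using assms(2) by blast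
  obtain e where e: "\<And>a. a \<in> A \<Longrightarrow> dist b a \<le> e"
    using assms(1) bounded_any_center[of A b] by auto
  have "infdist a B \<le> e" if "a \<in> A" for a
    using infdist_le[OF b, of a] e[OF that] by (simp add: dist_commute)
  then show ?thesis by (intro bdd_aboveI[of _ e]) auto
qed

lemma infdist_le_hausdorff:
  fixes A B :: "'a::metric_space set"
  assumes "bounded A" "B \<noteq> {}" "a \<in> A"
  shows "infdist a B \<le> hausdorff_distance A B"
  unfolding hausdorff_distance_def
  by (intro max.coboundedI1 cSUP_upper assms bdd_above_infdist)

lemma m2_dist_nonneg:
  assumes "x \<in> cadlag_paths" "0 \<le> T"
  shows "0 \<le> m2_dist T x y"
proof -
  have "completed_graph T y \<noteq> {}" using path_point_in_graph[of 0 T] assms(2) by blast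
  from infdist_le_hausdorff[OF bounded_completed_graph[OF assms(1)] this
      path_point_in_graph[of 0 T x]] assms(2) infdist_nonneg
  show ?thesis unfolding m2_dist_def by (metis order.refl order.trans)
qed

lemma m2_dist_near_point:
  assumes "x \<in> cadlag_paths" "0 \<le> t" "t \<le> T" "m2_dist T x y < e"
  obtains r z where "(r, z) \<in> completed_graph T y" "\<bar>t - r\<bar> < e" "\<bar>x t - z\<bar> < e"
proof -
  have ne: "completed_graph T y \<noteq> {}" using path_point_in_graph[of 0 T] assms by force
  have "infdist (t, x t) (completed_graph T y) < e"
    using infdist_le_hausdorff[OF bounded_completed_graph[OF assms(1)] ne
        path_point_in_graph[OF assms(2,3), of x]] assms(4)
    unfolding m2_dist_def by linarith
  then obtain p where p: "p \<in> completed_graph T y" "dist (t, x t) p < e"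
    using ne unfolding infdist_notempty[OF ne] by (subst (asm) cINF_less_iff) (auto intro: bdd_belowI[of _ 0])
  obtain r z where rz: "p = (r, z)" by (cases p)
  have "dist t r < e" "dist (x t) z < e"
    using p(2) dist_fst_le[of "(t, x t)" p] dist_snd_le[of "(t, x t)" p] by (auto simp: rz)
  with p(1) show thesis using that by (auto simp: rz dist_real_def)
qed

lemma m2_converges_const: "m2_converges (\<lambda>_. x) x"
proof -
  have "m2_dist T x x = 0" if "0 < T" for T
  proof -
    have "completed_graph T x \<noteq> {}" using path_point_in_graph[of 0 T] that by force
    then show ?thesis by (simp add: m2_dist_def hausdorff_distance_def)
  qed
  then show ?thesis by (simp add: m2_converges_def)
qed

lemma m2_converges_subseq:
  "m2_converges X x \<Longrightarrow> strict_mono r \<Longrightarrow> m2_converges (\<lambda>n. X (r n)) x"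
  unfolding m2_converges_def
  using LIMSEQ_subseq_LIMSEQ[of "\<lambda>n. m2_dist T (X n) x" for T, unfolded o_def] by blast

lemma m2_converges_eventually:
  assumes "m2_converges X x" "0 < T" "jump x T = 0" "0 < e"
  shows "\<forall>\<^sub>F n in sequentially. m2_dist T (X n) x < e"
proof -
  have "(\<lambda>n. m2_dist T (X n) x) \<longlonglongrightarrow> 0"
    using assms(1-3) by (simp add: m2_converges_def jump_def)
  then show ?thesis using assms(4) by (rule order_tendstoD(2))
qed

lemma m2_converges_locally_bounded:
  assumes X: "\<And>n. X n \<in> cadlag_paths" and x: "x \<in> cadlag_paths" and conv: "m2_converges X x"
  obtains K where "0 \<le> K" "\<forall>\<^sub>F n in sequentially. \<forall>s. 0 \<le> s \<and> s \<le> S \<longrightarrow> \<bar>X n s\<bar> \<le> K"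
proof -
  obtain T where T: "S < T" "0 < T" "jump x T = 0" using exists_continuity_time[OF x] .
  obtain K where K: "0 \<le> K" "\<And>s. 0 \<le> s \<Longrightarrow> s \<le> T \<Longrightarrow> \<bar>x s\<bar> \<le> K"
    using cadlag_bounded[OF x] by blast
  have "\<forall>\<^sub>F n in sequentially. \<forall>s. 0 \<le> s \<and> s \<le> S \<longrightarrow> \<bar>X n s\<bar> \<le> K + 1"
    using m2_converges_eventually[OF conv T(2,3) zero_less_one]
  proof eventually_elim
    case (elim n)
    show ?case
    proof (intro allI impI)
      fix s assume s: "0 \<le> s \<and> s \<le> S"
      then obtain r z where "(r, z) \<in> completed_graph T x" "\<bar>X n s - z\<bar> < 1"
        using m2_dist_near_point[OF X _ _ elim, of s] T(1) by (smt (verit, best))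
      then show "\<bar>X n s\<bar> \<le> K + 1" using graph_point_bounded[OF x _ K(2)] by force
    qed
  qed
  then show thesis using that[of "K + 1"] K(1) by simp
qed

text \<open>
  A point of the graph of \<open>X n\<close> over a time near \<open>t\<close> is close to a point of the completed graph
  of the limit, again over a time near \<open>t\<close>; if \<open>t\<close> is a continuity time of the limit, all such
  points are close to the limit value. Thus M2 convergence is continuous convergence there.
\<close>

lemma m2_converges_at_continuity_time:
  assumes X: "\<And>n. X n \<in> cadlag_paths" and x: "x \<in> cadlag_paths" and conv: "m2_converges X x"
    and t: "0 \<le> t" "jump x t = 0" and s: "\<And>n. 0 \<le> s n" "s \<longlonglongrightarrow> t"
  shows "(\<lambda>n. X n (s n)) \<longlonglongrightarrow> x t"
  unfolding tendsto_iff
proof (intro allI impI)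
  fix e :: real assume "0 < e"
  then have e: "0 < e / 2" by simp
  obtain T where T: "t < T" "0 < T" "jump x T = 0" using exists_continuity_time[OF x] .
  obtain d where d: "0 < d" "\<And>s. 0 \<le> s \<Longrightarrow> \<bar>s - t\<bar> < d \<Longrightarrow> \<bar>x s - x t\<bar> < e / 2"
    using cadlag_near_continuity_time[OF x t e] by blast
  have "\<forall>\<^sub>F n in sequentially. m2_dist T (X n) x < min (e / 2) (d / 2)"
    using e d(1) by (intro m2_converges_eventually[OF conv T(2,3)]) simp
  moreover have "\<forall>\<^sub>F n in sequentially. dist (s n) t < d / 2"
    using tendstoD[OF s(2), of "d / 2"] d(1) by simp
  moreover have "\<forall>\<^sub>F n in sequentially. s n < T"
    using order_tendstoD(2)[OF s(2) T(1)] .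
  ultimately show "\<forall>\<^sub>F n in sequentially. dist (X n (s n)) (x t) < e"
  proof eventually_elim
    case (elim n)
    obtain r z where p: "(r, z) \<in> completed_graph T x"
      and r: "\<bar>s n - r\<bar> < min (e / 2) (d / 2)" and z: "\<bar>X n (s n) - z\<bar> < min (e / 2) (d / 2)"
      using m2_dist_near_point[OF X s(1) less_imp_le[OF elim(3)] elim(1)] by blast
    have rt: "\<bar>r - t\<bar> < d" using r elim(2) unfolding dist_real_def min_less_iff_conj by argo
    have "\<bar>z - x t\<bar> \<le> e / 2"
    proof (rule graph_point_close[OF x p])
      show "t - d < r" using rt by simp
      show "\<bar>x u - x t\<bar> \<le> e / 2" if "0 \<le> u" "t - d < u" "u \<le> r" for u
        using that rt by (intro less_imp_le[OF d(2)]) auto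
    qed
    then show ?case using z unfolding dist_real_def min_less_iff_conj by argo
  qed
qed

text \<open>
  Between continuous paths, uniform closeness on a compact interval bounds the M2 distance,
  because points over equal times can be paired.
\<close>

lemma m2_dist_le_uniform:
  assumes x: "continuous_on {0..} x" and y: "continuous_on {0..} y" and T: "0 < T"
    and close: "\<And>t. 0 \<le> t \<Longrightarrow> t \<le> T \<Longrightarrow> \<bar>x t - y t\<bar> \<le> e"
  shows "m2_dist T x y \<le> e"
proof -
  have graph: "completed_graph T w = (\<lambda>t. (t, w t)) ` {0..T}" if "continuous_on {0..} w" for w
    using continuous_on_imp_jump_zero[OF that]
    by (fastforce simp: completed_graph_def jump_def)
  have *: "infdist p (completed_graph T w) \<le> e"
    if p: "p \<in> completed_graph T v" and v: "continuous_on {0..} v" "continuous_on {0..} w"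
      and vw: "\<And>t. 0 \<le> t \<Longrightarrow> t \<le> T \<Longrightarrow> \<bar>v t - w t\<bar> \<le> e" for p v w
  proof -
    obtain t where t: "0 \<le> t" "t \<le> T" "p = (t, v t)" using p graph[OF v(1)] by auto
    have "infdist p (completed_graph T w) \<le> dist p (t, w t)"
      by (rule infdist_le) (rule path_point_in_graph[OF t(1,2)])
    also have "\<dots> \<le> e" using vw[OF t(1,2)] by (simp add: t(3) dist_Pair_Pair dist_real_def)
    finally show ?thesis .
  qed
  have ne: "completed_graph T w \<noteq> {}" for w using path_point_in_graph[of 0 T] T by force
  show ?thesis
    unfolding m2_dist_def hausdorff_distance_def
  proof (intro max.boundedI cSUP_least ne)
    show "infdist p (completed_graph T y) \<le> e" if "p \<in> completed_graph T x" for p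
      using *[OF that x y close] .
    show "infdist p (completed_graph T x) \<le> e" if "p \<in> completed_graph T y" for p
      using *[OF that y x] close by (simp add: abs_minus_commute)
  qed
qed

lemma m2_converges_from_uniform:
  assumes X: "\<And>n. continuous_on {0..} (X n)" and x: "continuous_on {0..} x"
    and conv: "\<And>T e. 0 < T \<Longrightarrow> 0 < e \<Longrightarrow>
      \<forall>\<^sub>F n in sequentially. \<forall>t. 0 \<le> t \<and> t \<le> T \<longrightarrow> \<bar>X n t - x t\<bar> < e"
  shows "m2_converges X x"
  unfolding m2_converges_def
proof (intro allI impI)
  fix T :: real assume T: "0 < T"
  show "(\<lambda>n. m2_dist T (X n) x) \<longlonglongrightarrow> 0"
    unfolding tendsto_iff
  proof (intro allI impI)
    fix e :: real assume e: "0 < e"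
    then have "\<forall>\<^sub>F n in sequentially. \<forall>t. 0 \<le> t \<and> t \<le> T \<longrightarrow> \<bar>X n t - x t\<bar> < e / 2"
      using conv[OF T, of "e / 2"] by simp
    then show "\<forall>\<^sub>F n in sequentially. dist (m2_dist T (X n) x) 0 < e"
    proof eventually_elim
      case (elim n)
      have "m2_dist T (X n) x \<le> e / 2"
        using elim by (intro m2_dist_le_uniform X x T) (auto intro: less_imp_le)
      moreover have "0 \<le> m2_dist T (X n) x"
        using T by (intro m2_dist_nonneg continuous_on_imp_cadlag X) simp
      ultimately show ?case using e by (simp add: dist_real_def)
    qed
  qed
qed

text \<open>
  Continuous convergence to a continuous function is uniform on compact intervals: otherwise a
  subsequence of bad times would accumulate somewhere.
\<close>

lemma uniform_from_continuous_convergence: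
  fixes G :: "nat \<Rightarrow> real \<Rightarrow> real"
  assumes g: "continuous_on {0..} g" and e: "0 < e"
    and conv: "\<And>r s t. strict_mono r \<Longrightarrow> (\<And>k. 0 \<le> s k) \<Longrightarrow> 0 \<le> t \<Longrightarrow> s \<longlonglongrightarrow> t \<Longrightarrow>
      (\<lambda>k. G (r k) (s k)) \<longlonglongrightarrow> g t"
  shows "\<forall>\<^sub>F n in sequentially. \<forall>t. 0 \<le> t \<and> t \<le> T \<longrightarrow> \<bar>G n t - g t\<bar> < e"
proof (rule ccontr)
  assume "\<not> ?thesis"
  then obtain r :: "nat \<Rightarrow> nat" where r: "strict_mono r"
    and bad: "\<And>k. \<not> (\<forall>t. 0 \<le> t \<and> t \<le> T \<longrightarrow> \<bar>G (r k) t - g t\<bar> < e)"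
    using not_eventually_sequentiallyD by blast
  then have "\<forall>k. \<exists>t. t \<in> {0..T} \<and> \<not> \<bar>G (r k) t - g t\<bar> < e" by fastforce
  then obtain s where s: "\<And>k. s k \<in> {0..T}" "\<And>k. \<not> \<bar>G (r k) (s k) - g (s k)\<bar> < e"
    by metis
  obtain t q where t: "t \<in> {0..T}" and q: "strict_mono q" "(s \<circ> q) \<longlonglongrightarrow> t"
    using compact_Icc[of 0 T, unfolded compact_def, rule_format, of s] s(1) by blast
  have "(\<lambda>k. G ((r \<circ> q) k) ((s \<circ> q) k)) \<longlonglongrightarrow> g t"
    using t s(1) by (intro conv strict_mono_o r q) auto
  moreover have "(\<lambda>k. g ((s \<circ> q) k)) \<longlonglongrightarrow> g t"
    using g t s(1) q(2) unfolding continuous_on_sequentially by (auto simp: o_def)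
  ultimately have "(\<lambda>k. G ((r \<circ> q) k) ((s \<circ> q) k) - g ((s \<circ> q) k)) \<longlonglongrightarrow> 0"
    using tendsto_diff by fastforce
  from tendstoD[OF this e] have "\<forall>\<^sub>F k in sequentially. \<bar>G (r (q k)) (s (q k)) - g (s (q k))\<bar> < e"
    by (simp add: dist_real_def)
  then show False using s(2) by simp
qed

text \<open>
  The M2 topology being sequential, a map into it is continuous as soon as it preserves
  convergent sequences.
\<close>

lemma continuous_map_m2I:
  assumes into: "\<And>x. x \<in> cadlag_paths \<Longrightarrow> g x \<in> cadlag_paths"
    and conv: "\<And>X x. (\<And>n. X n \<in> cadlag_paths) \<Longrightarrow> x \<in> cadlag_paths \<Longrightarrow> m2_converges X x \<Longrightarrow>
      m2_converges (\<lambda>n. g (X n)) (g x)"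
  shows "continuous_map m2_topology m2_topology g"
  unfolding continuous_map_def topspace_m2_topology openin_m2_topology
proof (intro conjI allI impI)
  show "g \<in> cadlag_paths \<rightarrow> cadlag_paths" using into by blast
next
  fix U assume U: "m2_open U"
  show "m2_open {x \<in> cadlag_paths. g x \<in> U}"
    unfolding m2_open_def
  proof (intro conjI ballI allI impI)
    fix x X
    assume x: "x \<in> {x \<in> cadlag_paths. g x \<in> U}" and X: "\<forall>n. X n \<in> cadlag_paths"
      and c: "m2_converges X x"
    have "m2_converges (\<lambda>n. g (X n)) (g x)" using x X c by (intro conv) auto
    moreover have "\<forall>n. g (X n) \<in> cadlag_paths" using X into by blast
    ultimately have "\<forall>\<^sub>F n in sequentially. g (X n) \<in> U"
      using U x unfolding m2_open_def by auto
    then show "\<forall>\<^sub>F n in sequentially. X n \<in> {x \<in> cadlag_paths. g x \<in> U}"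
      using X by simp
  qed auto
qed

section \<open>The mean energy of the bridge\<close>

text \<open>
  The process \<open>v \<mapsto> x (t * v) - v * x t\<close> is the bridge obtained from the path \<open>x\<close> on \<open>{0..t}\<close>
  after rescaling time to the unit interval. Integrals over the unit interval treat the time
  \<open>t = 0\<close> on the same footing as positive times.
\<close>

definition bridge_energy :: "(real \<Rightarrow> real) \<Rightarrow> real \<Rightarrow> real" where
  "bridge_energy x t = (LBINT v:{0..1}. (x (t * v) - v * x t)\<^sup>2)"

definition mean_bridge_energy :: "(real \<Rightarrow> real) \<Rightarrow> real \<Rightarrow> real" where
  "mean_bridge_energy x t = (LBINT u:{0..1}. bridge_energy x (t * u))"

lemma unit_integral_cong:
  assumes "\<And>u. 0 \<le> u \<Longrightarrow> u \<le> 1 \<Longrightarrow> f u = g u"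
  shows "(LBINT u:{0..1::real}. f u) = (LBINT u:{0..1}. g u :: real)"
  unfolding set_lebesgue_integral_def using assms
  by (intro Bochner_Integration.integral_cong) (auto split: split_indicator)

lemma unit_integral_nonneg:
  assumes "\<And>u. 0 \<le> u \<Longrightarrow> u \<le> 1 \<Longrightarrow> 0 \<le> f u"
  shows "0 \<le> (LBINT u:{0..1::real}. f u :: real)"
  unfolding set_lebesgue_integral_def using assms
  by (intro integral_nonneg_AE AE_I2) (auto split: split_indicator)

lemma integrable_unit_const: "integrable lborel (\<lambda>u::real. indicator {0..1} u *\<^sub>R (C::real))"
  by (intro integrable_scaleR_left integrable_real_indicator) auto

lemma unit_integral_le:
  assumes "\<And>u. 0 \<le> u \<Longrightarrow> u \<le> 1 \<Longrightarrow> f u \<le> C" "0 \<le> C"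
  shows "(LBINT u:{0..1::real}. f u :: real) \<le> C"
proof (cases "integrable lborel (\<lambda>u. indicator {0..1} u *\<^sub>R f u)")
  case True
  have "(LBINT u:{0..1}. f u) \<le> (\<integral>u. indicator {0..1::real} u *\<^sub>R C \<partial>lborel)"
    unfolding set_lebesgue_integral_def
    by (intro integral_mono True integrable_unit_const) (auto split: split_indicator simp: assms)
  then show ?thesis by simp
next
  case False
  then show ?thesis by (simp add: set_lebesgue_integral_def not_integrable_integral_eq assms)
qed

lemma unit_integral_rescale:
  fixes f :: "real \<Rightarrow> real"
  assumes "0 < t"
  shows "(LBINT s:{0..t}. f s) = t * (LBINT v:{0..1}. f (t * v))"
proof -
  have "(LBINT s:{0..t}. f s) = t * (\<integral>v. indicator {0..t} (t * v) *\<^sub>R f (t * v) \<partial>lborel)"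
    unfolding set_lebesgue_integral_def
    using lborel_integral_real_affine[of t "\<lambda>s. indicator {0..t} s *\<^sub>R f s" 0] assms by simp
  also have "(\<lambda>v. indicator {0..t} (t * v) *\<^sub>R f (t * v)) = (\<lambda>v. indicator {0..1} v *\<^sub>R f (t * v))"
    using assms by (auto simp: fun_eq_iff zero_le_mult_iff split: split_indicator)
  finally show ?thesis by (simp add: set_lebesgue_integral_def)
qed

lemma bridge_energy_cong:
  assumes "\<And>s. 0 \<le> s \<Longrightarrow> s \<le> t \<Longrightarrow> x s = y s" "0 \<le> t"
  shows "bridge_energy x t = bridge_energy y t"
  unfolding bridge_energy_def
  by (intro unit_integral_cong) (use assms in \<open>simp add: mult_left_le\<close>)

lemma mean_bridge_energy_cong:
  assumes "\<And>s. 0 \<le> s \<Longrightarrow> s \<le> t \<Longrightarrow> x s = y s" "0 \<le> t"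
  shows "mean_bridge_energy x t = mean_bridge_energy y t"
  unfolding mean_bridge_energy_def
proof (intro unit_integral_cong bridge_energy_cong)
  fix u s :: real assume "0 \<le> u" "u \<le> 1" "0 \<le> s" "s \<le> t * u"
  then show "x s = y s" using assms mult_left_le[of u t] by force
qed (use assms in simp)

lemma mean_bridge_energy_nonneg: "0 \<le> mean_bridge_energy x t"
  unfolding mean_bridge_energy_def bridge_energy_def
  by (intro unit_integral_nonneg) simp

lemma bridge_bound:
  fixes a b v :: real
  assumes "\<bar>a\<bar> \<le> K" "\<bar>b\<bar> \<le> K" "0 \<le> v" "v \<le> 1"
  shows "(a - v * b)\<^sup>2 \<le> 4 * K\<^sup>2"
proof -
  have "\<bar>v * b\<bar> \<le> 1 * K" unfolding abs_mult using assms by (intro mult_mono) auto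
  then have "\<bar>a - v * b\<bar> \<le> 2 * K" using assms by linarith
  then have "\<bar>a - v * b\<bar>\<^sup>2 \<le> (2 * K)\<^sup>2" by (intro power_mono) auto
  then show ?thesis by (simp add: power_mult_distrib)
qed

lemma bridge_energy_le:
  assumes "\<And>s. 0 \<le> s \<Longrightarrow> s \<le> T \<Longrightarrow> \<bar>x s\<bar> \<le> K" "0 \<le> t" "t \<le> T"
  shows "bridge_energy x t \<le> 4 * K\<^sup>2"
  unfolding bridge_energy_def
proof (rule unit_integral_le)
  fix v :: real assume v: "0 \<le> v" "v \<le> 1"
  have "t * v \<le> T" using assms(2,3) v mult_left_le[of v t] by linarith
  then show "(x (t * v) - v * x t)\<^sup>2 \<le> 4 * K\<^sup>2"
    using assms v by (intro bridge_bound) auto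
qed simp

lemma mean_bridge_energy_le:
  assumes "\<And>s. 0 \<le> s \<Longrightarrow> s \<le> t \<Longrightarrow> \<bar>x s\<bar> \<le> K" "0 \<le> t"
  shows "mean_bridge_energy x t \<le> 4 * K\<^sup>2"
  unfolding mean_bridge_energy_def
  by (intro unit_integral_le bridge_energy_le[of t]) (use assms in \<open>auto simp: mult_left_le\<close>)

text \<open>Bridges do not see a linear trend, so centring by \<open>\<mu>\<close> has no effect on their energy.\<close>

lemma bridge_energy_rescale:
  "bridge_energy (\<lambda>s. c * (x (s / a) - s / a * m)) t = c\<^sup>2 * bridge_energy x (t / a)"
proof -
  have "(c * (x (t * v / a) - t * v / a * m) - v * (c * (x (t / a) - t / a * m)))\<^sup>2 =
      c\<^sup>2 * (x (t / a * v) - v * x (t / a))\<^sup>2" for v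
    by (simp add: algebra_simps flip: power_mult_distrib)
  then show ?thesis by (simp add: bridge_energy_def)
qed

lemma mean_bridge_energy_rescale:
  "mean_bridge_energy (\<lambda>s. c * (x (s / a) - s / a * m)) t = c\<^sup>2 * mean_bridge_energy x (t / a)"
  by (simp only: mean_bridge_energy_def bridge_energy_rescale) simp

lemma bridge_energy_zero_time: "x 0 = 0 \<Longrightarrow> bridge_energy x 0 = 0"
  by (simp add: bridge_energy_def)

lemma mean_bridge_energy_zero_time: "x 0 = 0 \<Longrightarrow> mean_bridge_energy x 0 = 0"
  by (simp add: mean_bridge_energy_def bridge_energy_zero_time)

lemma random_scaling_eq_bridge_energy:
  assumes "0 < t"
  shows "random_scaling Z t \<omega> = bridge_energy (\<lambda>s. Z s \<omega>) t"
  using assms by (simp add: random_scaling_def unit_integral_rescale[OF assms] bridge_energy_def)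

text \<open>
  At time zero the random scaling vanishes by convention, whereas the bridge energy is a third of
  the squared initial value; this is why the paths have to start at zero.
\<close>

lemma averaged_random_scaling_eq:
  assumes "Z 0 \<omega> = 0"
  shows "averaged_random_scaling Z t \<omega> = mean_bridge_energy (\<lambda>s. Z s \<omega>) (max 0 t)"
proof (cases "0 < t")
  case True
  have "random_scaling Z (t * u) \<omega> = bridge_energy (\<lambda>s. Z s \<omega>) (t * u)" if "0 \<le> u" for u
  proof (cases "u = 0")
    case True
    then show ?thesis using assms by (simp add: random_scaling_def bridge_energy_zero_time)
  next
    case False
    then show ?thesis using that \<open>0 < t\<close> by (intro random_scaling_eq_bridge_energy) simp
  qed
  then show ?thesis
    using True unit_integral_rescale[OF True, of "\<lambda>u. random_scaling Z u \<omega>"]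
    by (simp add: averaged_random_scaling_def mean_bridge_energy_def cong: unit_integral_cong)
next
  case False
  then show ?thesis
    by (simp add: averaged_random_scaling_def mean_bridge_energy_zero_time assms max_absorb1)
qed

lemma bridge_energy_measurable [measurable]:
  assumes [measurable]: "x \<in> borel_measurable borel"
  shows "bridge_energy x \<in> borel_measurable borel"
  unfolding bridge_energy_def[abs_def] set_lebesgue_integral_def by measurable

lemma unit_integral_dominated_convergence:
  fixes f :: "nat \<Rightarrow> real \<Rightarrow> real"
  assumes [measurable]: "\<And>n. f n \<in> borel_measurable borel" "g \<in> borel_measurable borel"
    and bound: "\<And>n u. 0 \<le> u \<Longrightarrow> u \<le> 1 \<Longrightarrow> \<bar>f n u\<bar> \<le> C"
    and C: "countable C'"
    and conv: "\<And>u. 0 \<le> u \<Longrightarrow> u \<le> 1 \<Longrightarrow> u \<notin> C' \<Longrightarrow> (\<lambda>n. f n u) \<longlonglongrightarrow> g u"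
  shows "(\<lambda>n. LBINT u:{0..1}. f n u) \<longlonglongrightarrow> (LBINT u:{0..1}. g u)"
  unfolding set_lebesgue_integral_def
proof (rule integral_dominated_convergence)
  show "integrable lborel (\<lambda>u::real. indicator {0..1} u *\<^sub>R C)" by (rule integrable_unit_const)
  have "AE u in lborel. u \<notin> C'" by (intro AE_not_in countable_imp_null_set_lborel C)
  then show "AE u in lborel. (\<lambda>n. indicator {0..1} u *\<^sub>R f n u) \<longlonglongrightarrow> indicator {0..1} u *\<^sub>R g u"
    by eventually_elim (auto intro!: tendsto_scaleR tendsto_const conv split: split_indicator)
  show "AE u in lborel. norm (indicator {0..1} u *\<^sub>R f n u) \<le> indicator {0..1} u *\<^sub>R C" for n
    using bound by (auto split: split_indicator)
qed measurable

lemma countable_rescaled_times: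
  assumes "countable C" "0 \<notin> C"
  shows "countable {u::real. t * u \<in> C}"
proof (cases "t = 0")
  case True then show ?thesis using assms by simp
next
  case False
  have "{u. t * u \<in> C} \<subseteq> (\<lambda>s. s / t) ` C"
  proof
    fix u assume "u \<in> {u. t * u \<in> C}"
    then show "u \<in> (\<lambda>s. s / t) ` C" using False by (intro image_eqI[of _ _ "t * u"]) auto
  qed
  then show ?thesis using assms(1) countable_image countable_subset by blast
qed

lemma bridge_energy_tendsto:
  assumes meas [measurable]: "\<And>n. x n \<in> borel_measurable borel" "y \<in> borel_measurable borel"
    and bound: "\<And>n s. 0 \<le> s \<Longrightarrow> s \<le> T \<Longrightarrow> \<bar>x n s\<bar> \<le> K"
    and C: "countable C" "0 \<notin> C"
    and conv: "\<And>s r. 0 \<le> r \<Longrightarrow> r \<notin> C \<Longrightarrow> (\<And>n. 0 \<le> s n) \<Longrightarrow> s \<longlonglongrightarrow> r \<Longrightarrow> (\<lambda>n. x n (s n)) \<longlonglongrightarrow> y r"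
    and t: "\<And>n. 0 \<le> t n" "\<And>n. t n \<le> T" "0 \<le> t'" "t' \<notin> C" "t \<longlonglongrightarrow> t'"
  shows "(\<lambda>n. bridge_energy (x n) (t n)) \<longlonglongrightarrow> bridge_energy y t'"
  unfolding bridge_energy_def
proof (rule unit_integral_dominated_convergence[where C' = "{v. t' * v \<in> C}"])
  fix n and v :: real assume v: "0 \<le> v" "v \<le> 1"
  have "t n * v \<le> T" using mult_left_le[of v "t n"] t(1)[of n] t(2)[of n] v by linarith
  then have "(x n (t n * v) - v * x n (t n))\<^sup>2 \<le> 4 * K\<^sup>2"
    using t(1,2) v by (intro bridge_bound bound) auto
  then show "\<bar>(x n (t n * v) - v * x n (t n))\<^sup>2\<bar> \<le> 4 * K\<^sup>2" by simp
next
  fix v :: real assume v: "0 \<le> v" "v \<le> 1" "v \<notin> {v. t' * v \<in> C}"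
  have "(\<lambda>n. x n (t n * v)) \<longlonglongrightarrow> y (t' * v)"
    by (intro conv tendsto_mult t tendsto_const) (use v t in auto)
  moreover have "(\<lambda>n. x n (t n)) \<longlonglongrightarrow> y t'" by (intro conv t)
  ultimately show "(\<lambda>n. (x n (t n * v) - v * x n (t n))\<^sup>2) \<longlonglongrightarrow> (y (t' * v) - v * y t')\<^sup>2"
    by (intro tendsto_intros)
qed (use countable_rescaled_times[OF C] in simp_all)

lemma mean_bridge_energy_tendsto:
  assumes meas [measurable]: "\<And>n. x n \<in> borel_measurable borel" "y \<in> borel_measurable borel"
    and bound: "\<And>n s. 0 \<le> s \<Longrightarrow> s \<le> T \<Longrightarrow> \<bar>x n s\<bar> \<le> K"
    and C: "countable C" "0 \<notin> C"
    and conv: "\<And>s r. 0 \<le> r \<Longrightarrow> r \<notin> C \<Longrightarrow> (\<And>n. 0 \<le> s n) \<Longrightarrow> s \<longlonglongrightarrow> r \<Longrightarrow> (\<lambda>n. x n (s n)) \<longlonglongrightarrow> y r"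
    and t: "\<And>n. 0 \<le> t n" "\<And>n. t n \<le> T" "0 \<le> t'" "t \<longlonglongrightarrow> t'"
  shows "(\<lambda>n. mean_bridge_energy (x n) (t n)) \<longlonglongrightarrow> mean_bridge_energy y t'"
  unfolding mean_bridge_energy_def
proof (rule unit_integral_dominated_convergence[where C' = "{u. t' * u \<in> C}"])
  fix n and u :: real assume u: "0 \<le> u" "u \<le> 1"
  have "t n * u \<le> T" using mult_left_le[of u "t n"] t(1)[of n] t(2)[of n] u by linarith
  then have "bridge_energy (x n) (t n * u) \<le> 4 * K\<^sup>2"
    using t(1,2) u by (intro bridge_energy_le[of T] bound) auto
  moreover have "0 \<le> bridge_energy (x n) (t n * u)"
    unfolding bridge_energy_def by (intro unit_integral_nonneg) simp
  ultimately show "\<bar>bridge_energy (x n) (t n * u)\<bar> \<le> 4 * K\<^sup>2" by simp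
next
  fix u :: real assume u: "0 \<le> u" "u \<le> 1" "u \<notin> {u. t' * u \<in> C}"
  have le: "t n * u \<le> T" for n
    using mult_left_le[of u "t n"] t(1)[of n] t(2)[of n] u by linarith
  show "(\<lambda>n. bridge_energy (x n) (t n * u)) \<longlonglongrightarrow> bridge_energy y (t' * u)"
    by (rule bridge_energy_tendsto[OF meas bound C conv])
      (use u t le in \<open>auto intro!: tendsto_intros\<close>)
qed (use countable_rescaled_times[OF C] in simp_all)

text \<open>
  An M2 convergent sequence converges continuously off the countably many jump times of the
  limit, and these are negligible for both integrals.
\<close>

lemma mean_bridge_energy_continuous_convergence:
  assumes X: "\<And>n. X n \<in> cadlag_paths" and x: "x \<in> cadlag_paths" and conv: "m2_converges X x"
    and t: "\<And>n. 0 \<le> t n" "0 \<le> t'" "t \<longlonglongrightarrow> t'"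
  shows "(\<lambda>n. mean_bridge_energy (X n) (t n)) \<longlonglongrightarrow> mean_bridge_energy x t'"
proof -
  obtain T where T: "\<And>n. t n \<le> T"
    using convergent_imp_bounded[OF t(3)] unfolding bounded_iff
    by (metis abs_ge_self order_trans rangeI real_norm_def)
  obtain K where K: "0 \<le> K"
    "\<forall>\<^sub>F n in sequentially. \<forall>s. 0 \<le> s \<and> s \<le> T \<longrightarrow> \<bar>X n s\<bar> \<le> K"
    using m2_converges_locally_bounded[OF X x conv] by blast
  then obtain n0 where n0: "\<And>n s. n0 \<le> n \<Longrightarrow> 0 \<le> s \<Longrightarrow> s \<le> T \<Longrightarrow> \<bar>X n s\<bar> \<le> K"
    unfolding eventually_sequentially by blast
  have conv': "m2_converges (\<lambda>n. X (n + n0)) x"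
    by (rule m2_converges_subseq[OF conv]) (simp add: strict_mono_def)
  \<comment> \<open>Nothing is known about the paths at negative times; extending them by their initial
    value makes them measurable on the whole line.\<close>
  have "(\<lambda>n. mean_bridge_energy (\<lambda>s. X (n + n0) (max 0 s)) (t (n + n0))) \<longlonglongrightarrow>
      mean_bridge_energy (\<lambda>s. x (max 0 s)) t'"
  proof (rule mean_bridge_energy_tendsto[where T = T and K = K and C = "{s. 0 \<le> s \<and> jump x s \<noteq> 0}"])
    fix s :: "nat \<Rightarrow> real" and r
    assume "0 \<le> r" "r \<notin> {s. 0 \<le> s \<and> jump x s \<noteq> 0}" "\<And>n. 0 \<le> s n" "s \<longlonglongrightarrow> r"
    then show "(\<lambda>n. X (n + n0) (max 0 (s n))) \<longlonglongrightarrow> x (max 0 r)"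
      using m2_converges_at_continuity_time[OF X x conv', of r s] by (simp add: max_absorb2)
  qed (use n0 t T in \<open>auto intro: cadlag_measurable X x countable_jumps LIMSEQ_ignore_initial_segment\<close>)
  moreover have "mean_bridge_energy (\<lambda>s. y (max 0 s)) r = mean_bridge_energy y r" if "0 \<le> r" for y r
    using that by (intro mean_bridge_energy_cong) (simp_all add: max_absorb2)
  ultimately have "(\<lambda>n. mean_bridge_energy (X (n + n0)) (t (n + n0))) \<longlonglongrightarrow> mean_bridge_energy x t'"
    using t by simp
  then show ?thesis by (rule LIMSEQ_offset)
qed

lemma continuous_on_mean_bridge_energy:
  assumes x: "x \<in> cadlag_paths"
  shows "continuous_on {0..} (mean_bridge_energy x)"
  unfolding continuous_on_sequentially
  using mean_bridge_energy_continuous_convergence[OF x x m2_converges_const]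
  by (auto simp: o_def)

text \<open>
  Truncating time at zero makes this path agree at every real time with the rescaled square root of
  an averaged random scaling. Its value at time zero is the limit from the right, whatever the initial
  value of \<open>x\<close>, so that all cadlag paths are sent to continuous ones.
\<close>

definition root_energy :: "(real \<Rightarrow> real) \<Rightarrow> real \<Rightarrow> real" where
  "root_energy x t = sqrt (mean_bridge_energy x (max 0 t))"

text \<open>
  Mean bridge energies of M2 convergent paths converge continuously at every time, because
  integration removes the exceptional jump times. Their limits are continuous paths, for which
  this amounts to uniform convergence on compact intervals and so implies M2 convergence.
\<close>

lemma continuous_map_root_energy:
  "continuous_map m2_topology m2_topology root_energy"
proof (rule continuous_map_m2I)
  have cont: "continuous_on {0..} (root_energy x)" if "x \<in> cadlag_paths" for x
  proof -
    have "continuous_on {0..} (\<lambda>t. sqrt (mean_bridge_energy x t))"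
      by (intro continuous_intros continuous_on_mean_bridge_energy that)
    then show ?thesis
      by (rule continuous_on_eq) (simp add: root_energy_def max_absorb2)
  qed
  show "root_energy x \<in> cadlag_paths" if "x \<in> cadlag_paths" for x
    by (rule continuous_on_imp_cadlag[OF cont[OF that]])
  fix X :: "nat \<Rightarrow> real \<Rightarrow> real" and x
  assume X: "\<And>n. X n \<in> cadlag_paths" and x: "x \<in> cadlag_paths" and conv: "m2_converges X x"
  show "m2_converges (\<lambda>n. root_energy (X n)) (root_energy x)"
  proof (rule m2_converges_from_uniform[OF cont[OF X] cont[OF x]])
    fix T e :: real assume "0 < e"
    then show "\<forall>\<^sub>F n in sequentially. \<forall>t. 0 \<le> t \<and> t \<le> T \<longrightarrow> \<bar>root_energy (X n) t - root_energy x t\<bar> < e"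
    proof (rule uniform_from_continuous_convergence[OF cont[OF x]])
      fix r :: "nat \<Rightarrow> nat" and s :: "nat \<Rightarrow> real" and t
      assume "strict_mono r" "\<And>k. 0 \<le> s k" "0 \<le> t" "s \<longlonglongrightarrow> t"
      then show "(\<lambda>k. root_energy (X (r k)) (s k)) \<longlonglongrightarrow> root_energy x t"
        unfolding root_energy_def
        using mean_bridge_energy_continuous_convergence[OF X x m2_converges_subseq[OF conv]]
        by (simp add: max_absorb2 tendsto_real_sqrt)
    qed
  qed
qed

text \<open>
  The centring is a linear trend and drops out, and the normalising factor, being positive,
  passes through the square root.
\<close>

lemma root_energy_rescaled_centred:
  assumes "0 < \<epsilon>" "0 < l (1 / \<epsilon>)" "Z 0 \<omega> = 0"
  shows "root_energy (rescaled_centred \<mu> h l \<epsilon> Z \<omega>) =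
    rescaled_sqrt h l \<epsilon> (averaged_random_scaling Z) \<omega>"
proof
  fix t
  have "max 0 t / \<epsilon> = max 0 (t / \<epsilon>)"
    using assms(1) by (simp add: max_def divide_le_0_iff zero_le_divide_iff)
  then show "root_energy (rescaled_centred \<mu> h l \<epsilon> Z \<omega>) t =
      rescaled_sqrt h l \<epsilon> (averaged_random_scaling Z) \<omega> t"
    using assms mean_bridge_energy_rescale[of "\<epsilon> powr h * l (1 / \<epsilon>)" "\<lambda>s. Z s \<omega>" \<epsilon> \<mu> "max 0 t"]
    by (simp add: root_energy_def rescaled_centred_def rescaled_sqrt_def
        averaged_random_scaling_eq real_sqrt_mult)
qed

text \<open>
  The energy of a path on \<open>{0..t}\<close> is at most four times the square of its supremum, and the
  supremum is \<open>o(t)\<close>.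
\<close>

lemma mean_bridge_energy_sublinear:
  assumes lim: "((\<lambda>t. x t / t) \<longlongrightarrow> 0) at_top"
    and bounded: "\<And>T. \<exists>K. \<forall>s. 0 \<le> s \<and> s \<le> T \<longrightarrow> \<bar>x s\<bar> \<le> K"
  shows "((\<lambda>t. mean_bridge_energy x t / t\<^sup>2) \<longlongrightarrow> 0) at_top"
  unfolding tendsto_iff
proof (intro allI impI)
  fix e :: real assume e: "0 < e"
  \<comment> \<open>Once the path stays below \<open>d * t\<close>, the quotient is at most \<open>4 * d\<^sup>2\<close>, here \<open>e / 4\<close>.\<close>
  define d where "d = sqrt e / 4"
  have d: "0 < d" "4 * d\<^sup>2 < e" using e by (simp_all add: d_def power_divide)
  obtain T where T: "\<And>s. T \<le> s \<Longrightarrow> \<bar>x s / s\<bar> < d"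
    using tendstoD[OF lim d(1)] unfolding eventually_at_top_linorder dist_real_def by auto
  obtain K where K: "\<And>s. 0 \<le> s \<Longrightarrow> s \<le> max 1 T \<Longrightarrow> \<bar>x s\<bar> \<le> K" using bounded by blast
  \<comment> \<open>From time \<open>K / d\<close> on, even the bound \<open>K\<close> on the initial stretch is below \<open>d * t\<close>.\<close>
  show "\<forall>\<^sub>F t in at_top. dist (mean_bridge_energy x t / t\<^sup>2) 0 < e"
    using eventually_ge_at_top[of "max 1 T"] eventually_ge_at_top[of "K / d"]
  proof eventually_elim
    case (elim t)
    have t: "0 < t" using elim(1) by simp
    have "\<bar>x s\<bar> \<le> d * t" if s: "0 \<le> s" "s \<le> t" for s
    proof (cases "s \<le> max 1 T")
      case True
      then have "\<bar>x s\<bar> \<le> K" using K s by blast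
      also have "K \<le> d * t" using elim(2) d(1) by (simp add: field_simps)
      finally show ?thesis .
    next
      case False
      then have "\<bar>x s\<bar> < d * s" using T[of s] by (simp add: field_simps)
      also have "d * s \<le> d * t" using s d(1) by simp
      finally show ?thesis by simp
    qed
    then have "mean_bridge_energy x t \<le> 4 * (d * t)\<^sup>2"
      using t by (intro mean_bridge_energy_le) auto
    then have "mean_bridge_energy x t / t\<^sup>2 \<le> 4 * d\<^sup>2"
      using t by (simp add: field_simps)
    then show ?case using d(2) mean_bridge_energy_nonneg[of x t] by (simp add: dist_real_def)
  qed
qed

text \<open>The integral defining \<open>t * mean_bridge_energy x t\<close> has a nonnegative integrand.\<close>

lemma mean_bridge_energy_pos_mono:
  assumes x: "x \<in> cadlag_paths" and st: "0 < s" "s \<le> t" and pos: "0 < mean_bridge_energy x s"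
  shows "0 < mean_bridge_energy x t"
proof -
  define y where "y r = x (max 0 r)" for r
  have [measurable]: "y \<in> borel_measurable borel"
    unfolding y_def[abs_def] by (rule cadlag_measurable[OF x])
  obtain K where K: "\<And>r. 0 \<le> r \<Longrightarrow> r \<le> t \<Longrightarrow> \<bar>y r\<bar> \<le> K"
    using cadlag_bounded[OF x, of t] by (metis y_def max_absorb2)
  have eq: "mean_bridge_energy x r = mean_bridge_energy y r" if "0 \<le> r" for r
    using that by (intro mean_bridge_energy_cong) (simp_all add: y_def max_absorb2)
  have nonneg: "0 \<le> bridge_energy y r" for r
    unfolding bridge_energy_def by (intro unit_integral_nonneg) simp
  have integrable: "integrable lborel (\<lambda>r. indicator {0..u} r *\<^sub>R bridge_energy y r)" if "u \<le> t" for u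
  proof (rule Bochner_Integration.integrable_bound)
    show "integrable lborel (\<lambda>r. indicator {0..t} r *\<^sub>R (4 * K\<^sup>2))"
      by (intro integrable_scaleR_left integrable_real_indicator)
        (auto simp: emeasure_lborel_Icc_eq)
    show "AE r in lborel. norm (indicator {0..u} r *\<^sub>R bridge_energy y r)
        \<le> norm (indicator {0..t} r *\<^sub>R (4 * K\<^sup>2))"
      using bridge_energy_le[of t y K] K that nonneg by (auto split: split_indicator)
  qed simp
  have "(LBINT r:{0..s}. bridge_energy y r) \<le> (LBINT r:{0..t}. bridge_energy y r)"
    unfolding set_lebesgue_integral_def using st nonneg
    by (intro integral_mono integrable) (auto split: split_indicator)
  moreover have "0 < (LBINT r:{0..s}. bridge_energy y r)"
    using pos st unit_integral_rescale[of s "bridge_energy y"] eq[of s]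
    by (simp add: mean_bridge_energy_def)
  ultimately have "0 < t * mean_bridge_energy y t"
    using st unit_integral_rescale[of t "bridge_energy y"]
    by (simp add: mean_bridge_energy_def)
  then show ?thesis using st eq[of t] by (simp add: zero_less_mult_iff)
qed

section \<open>Almost sure modifications on completed spaces\<close>

lemma measurable_completion_cong_AE:
  assumes f: "f \<in> completion M \<rightarrow>\<^sub>M B" and g: "g \<in> space M \<rightarrow> space B"
    and eq: "AE \<omega> in M. f \<omega> = g \<omega>"
  shows "g \<in> completion M \<rightarrow>\<^sub>M B"
proof (rule measurableI)
  show "g \<omega> \<in> space B" if "\<omega> \<in> space (completion M)" for \<omega> using g that by auto
  fix A assume A: "A \<in> sets B"
  define E where "E = {\<omega> \<in> space M. f \<omega> \<noteq> g \<omega>}"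
  have E: "E \<in> null_sets (completion M)"
    using AE_completion[OF eq] completion.AE_iff_null_sets[of "\<lambda>\<omega>. f \<omega> = g \<omega>" M]
    by (simp add: E_def)
  have "g -` A \<inter> E \<in> null_sets (completion M)"
    by (rule null_sets_completion_subset[OF _ E]) simp
  moreover have "f -` A \<inter> space (completion M) \<in> sets (completion M)"
    by (rule measurable_sets[OF f A])
  ultimately have "(f -` A \<inter> space (completion M) - E) \<union> (g -` A \<inter> E) \<in> sets (completion M)"
    using E by (intro sets.Un sets.Diff) (auto dest: null_setsD2)
  also have "(f -` A \<inter> space (completion M) - E) \<union> (g -` A \<inter> E) = g -` A \<inter> space (completion M)"
    by (auto simp: E_def)
  finally show "g -` A \<inter> space (completion M) \<in> sets (completion M)" .
qed

text \<open>
  Of two almost surely equal functions on a complete space either both are measurable or neither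
  is, and in the latter case both integrals are zero by convention.
\<close>

lemma integral_completion_cong_AE:
  fixes f g :: "'a \<Rightarrow> real"
  assumes eq: "AE \<omega> in M. f \<omega> = g \<omega>"
  shows "(\<integral>\<omega>. f \<omega> \<partial>completion M) = (\<integral>\<omega>. g \<omega> \<partial>completion M)"
proof (cases "f \<in> borel_measurable (completion M)")
  case True
  moreover have "g \<in> borel_measurable (completion M)"
    by (rule measurable_completion_cong_AE[OF True _ eq]) simp
  ultimately show ?thesis by (intro integral_cong_AE AE_completion eq)
next
  case False
  then have "g \<notin> borel_measurable (completion M)"
    using measurable_completion_cong_AE[of g M borel f] eq by (auto simp: eq_commute)
  then show ?thesis
    using False by (metis borel_measurable_integrable not_integrable_integral_eq)
qed

section \<open>The continuous mapping step\<close>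

text \<open>
  A test function on the product composed with \<open>\<lambda>x. (x, root_energy x)\<close> is a test function for the
  given M2 limit. On the almost sure event that the paths start at zero, the composition evaluated
  at the processes is the test function evaluated at the pairs.
\<close>

lemma functional_weak_limit_averaged_random_scaling:
  assumes Z0: "AE \<omega> in M. Z 0 \<omega> = 0" and Y0: "AE \<omega> in N. Y 0 \<omega> = 0"
    and l: "\<forall>\<^sub>F x in at_top. 0 < l x"
    and conv: "converges_weakly m2_topology M (\<lambda>\<epsilon>. rescaled_centred \<mu> h l \<epsilon> Z)
      N (\<lambda>\<omega> t. Y t \<omega>) (at_right 0)"
  shows "functional_weak_limit M Z (averaged_random_scaling Z) \<mu> h l N Y (averaged_random_scaling Y)"
  unfolding functional_weak_limit_def converges_weakly_def
proof (intro allI impI)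
  fix f :: "(real \<Rightarrow> real) \<times> (real \<Rightarrow> real) \<Rightarrow> real"
  assume f: "continuous_map wm2_topology euclideanreal f" and bdd: "bounded (f ` topspace wm2_topology)"
  define F where "F x = f (x, root_energy x)" for x
  have pair: "continuous_map m2_topology wm2_topology (\<lambda>x. (x, root_energy x))"
    unfolding wm2_topology_def
    by (intro continuous_map_pairedI continuous_map_id[unfolded id_def] continuous_map_root_energy)
  have "continuous_map m2_topology euclideanreal F"
    using continuous_map_compose[OF pair f] by (simp add: o_def F_def[abs_def])
  moreover have "F ` topspace m2_topology \<subseteq> f ` topspace wm2_topology"
    using continuous_map_image_subset_topspace[OF pair] by (auto simp: F_def)
  then have "bounded (F ` topspace m2_topology)" by (rule bounded_subset[OF bdd])
  ultimately have "((\<lambda>\<epsilon>. \<integral>\<omega>. F (rescaled_centred \<mu> h l \<epsilon> Z \<omega>) \<partial>completion M) \<longlongrightarrow>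
      (\<integral>\<omega>. F (\<lambda>t. Y t \<omega>) \<partial>completion N)) (at_right 0)"
    using conv unfolding converges_weakly_def by blast
  moreover have "(\<integral>\<omega>. F (\<lambda>t. Y t \<omega>) \<partial>completion N) =
      (\<integral>\<omega>. f (\<lambda>t. Y t \<omega>, \<lambda>t. sqrt (averaged_random_scaling Y t \<omega>)) \<partial>completion N)"
  proof (rule integral_completion_cong_AE)
    show "AE \<omega> in N. F (\<lambda>t. Y t \<omega>) = f (\<lambda>t. Y t \<omega>, \<lambda>t. sqrt (averaged_random_scaling Y t \<omega>))"
      using Y0 by eventually_elim (simp add: F_def root_energy_def[abs_def] averaged_random_scaling_eq)
  qed
  moreover have "\<forall>\<^sub>F \<epsilon> in at_right 0. (\<integral>\<omega>. F (rescaled_centred \<mu> h l \<epsilon> Z \<omega>) \<partial>completion M) =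
      (\<integral>\<omega>. f (rescaled_centred \<mu> h l \<epsilon> Z \<omega>, rescaled_sqrt h l \<epsilon> (averaged_random_scaling Z) \<omega>)
        \<partial>completion M)"
    using eventually_compose_filterlim[OF l filterlim_inverse_at_top_right]
      eventually_at_right_less[of 0]
  proof eventually_elim
    case (elim \<epsilon>)
    show ?case
    proof (rule integral_completion_cong_AE)
      show "AE \<omega> in M. F (rescaled_centred \<mu> h l \<epsilon> Z \<omega>) =
          f (rescaled_centred \<mu> h l \<epsilon> Z \<omega>, rescaled_sqrt h l \<epsilon> (averaged_random_scaling Z) \<omega>)"
        using Z0 by eventually_elim
          (use elim in \<open>simp add: F_def root_energy_rescaled_centred inverse_eq_divide\<close>)
    qed
  qed
  ultimately show "((\<lambda>\<epsilon>. \<integral>\<omega>. f (rescaled_centred \<mu> h l \<epsilon> Z \<omega>,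
        rescaled_sqrt h l \<epsilon> (averaged_random_scaling Z) \<omega>) \<partial>completion M) \<longlongrightarrow>
      (\<integral>\<omega>. f (\<lambda>t. Y t \<omega>, \<lambda>t. sqrt (averaged_random_scaling Y t \<omega>)) \<partial>completion N)) (at_right 0)"
    using tendsto_cong by fastforce
qed

section \<open>A measurable version of averaged random scaling on path space\<close>

text \<open>
  A path in the product space is an arbitrary function, but the values that it takes on the grids
  \<open>{k / n | k}\<close> determine it when it is right-continuous. The grid points are cut off at \<open>u\<close>
  so that no value beyond \<open>u\<close> is used: this makes averaged random scaling adapted.
\<close>

definition resampled :: "real \<Rightarrow> (real \<Rightarrow> real) \<Rightarrow> real \<Rightarrow> real" where
  "resampled u x t =
     lim (\<lambda>n. x (min u (max 0 (real_of_int \<lceil>real (Suc n) * t\<rceil> / real (Suc n)))))"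

lemma resampled_restrict: "0 \<le> u \<Longrightarrow> resampled u (restrict x {0..u}) t = resampled u x t"
  by (simp add: resampled_def)

lemma resampled_cadlag:
  assumes x: "x \<in> cadlag_paths" and t: "0 \<le> t" "t \<le> u"
  shows "resampled u x t = x t"
proof -
  define s where "s n = min u (max 0 (real_of_int \<lceil>real (Suc n) * t\<rceil> / real (Suc n)))" for n
  have ge: "t \<le> s n" for n
  proof -
    have "real (Suc n) * t \<le> real_of_int \<lceil>real (Suc n) * t\<rceil>" by (rule le_of_int_ceiling)
    then have "t \<le> real_of_int \<lceil>real (Suc n) * t\<rceil> / real (Suc n)"
      by (simp only: pos_le_divide_eq of_nat_0_less_iff zero_less_Suc mult.commute)
    then show ?thesis using t by (simp add: s_def)
  qed
  have le: "s n \<le> t + 1 / real (Suc n)" for n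
  proof -
    have "real_of_int \<lceil>real (Suc n) * t\<rceil> \<le> real (Suc n) * t + 1" by linarith
    then have "real_of_int \<lceil>real (Suc n) * t\<rceil> / real (Suc n) \<le> (real (Suc n) * t + 1) / real (Suc n)"
      by (intro divide_right_mono) auto
    also have "\<dots> = t + 1 / real (Suc n)" by (simp add: field_simps)
    finally show ?thesis
      unfolding s_def using t(1) by (intro min.coboundedI2 max.boundedI add_nonneg_nonneg) auto
  qed
  have "(\<lambda>n. x (s n)) \<longlonglongrightarrow> x t"
    unfolding tendsto_iff
  proof (intro allI impI)
    fix e :: real assume "0 < e"
    then obtain d where d: "0 < d" "\<And>s. t \<le> s \<Longrightarrow> s < t + d \<Longrightarrow> \<bar>x s - x t\<bar> < e"
      using cadlag_near_right[OF x t(1)] by blast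
    have "\<forall>\<^sub>F n in sequentially. 1 / real (Suc n) < d"
      using order_tendstoD(2)[OF LIMSEQ_inverse_real_of_nat d(1)] by (simp add: inverse_eq_divide)
    then show "\<forall>\<^sub>F n in sequentially. dist (x (s n)) (x t) < e"
    proof eventually_elim
      case (elim n)
      have "s n < t + d" using le[of n] elim by linarith
      then show ?case using d(2)[OF ge] by (simp add: dist_real_def)
    qed
  qed
  then show ?thesis unfolding resampled_def s_def[symmetric] by (rule limI)
qed

lemma resampled_measurable [measurable (raw)]:
  assumes u: "0 \<le> u" and f: "f \<in> M \<rightarrow>\<^sub>M Pi\<^sub>M {0..u} (\<lambda>_. borel)"
    and g [measurable]: "g \<in> borel_measurable M"
  shows "(\<lambda>w. resampled u (f w) (g w)) \<in> borel_measurable M"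
  unfolding resampled_def
proof (rule borel_measurable_lim_metric)
  fix n
  show "(\<lambda>w. f w (min u (max 0 (real_of_int \<lceil>real (Suc n) * g w\<rceil> / real (Suc n)))))
      \<in> borel_measurable M"
  proof (rule measurable_compose_countable[where
        f = "\<lambda>i w. f w (min u (max 0 (real_of_int i / real (Suc n))))"])
    show "(\<lambda>w. f w (min u (max 0 (real_of_int i / real (Suc n))))) \<in> borel_measurable M" for i :: int
      using measurable_compose[OF f measurable_component_singleton] u by simp
    show "(\<lambda>w. \<lceil>real (Suc n) * g w\<rceil>) \<in> M \<rightarrow>\<^sub>M count_space UNIV" by measurable
  qed
qed

definition energy_functional :: "real \<Rightarrow> (real \<Rightarrow> real) \<Rightarrow> real" where
  "energy_functional u x = mean_bridge_energy (resampled u x) u"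

lemma energy_functional_measurable:
  assumes [simp]: "0 \<le> u" and [measurable]: "f \<in> M \<rightarrow>\<^sub>M Pi\<^sub>M {0..u} (\<lambda>_. borel)"
  shows "(\<lambda>w. energy_functional u (f w)) \<in> borel_measurable M"
  unfolding energy_functional_def mean_bridge_energy_def bridge_energy_def set_lebesgue_integral_def
  by measurable

lemma averaged_random_scaling_eq_functional:
  assumes "(\<lambda>t. Z t \<omega>) \<in> cadlag_paths" "Z 0 \<omega> = 0" "0 \<le> u"
  shows "averaged_random_scaling Z u \<omega> = energy_functional u (\<lambda>t\<in>{0..u}. Z t \<omega>)"
proof -
  have "energy_functional u (\<lambda>t\<in>{0..u}. Z t \<omega>) = mean_bridge_energy (\<lambda>t. Z t \<omega>) u"
    unfolding energy_functional_def using assms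
    by (intro mean_bridge_energy_cong) (simp_all add: resampled_restrict resampled_cadlag)
  then show ?thesis using assms by (simp add: averaged_random_scaling_eq max_absorb2)
qed

lemma path_map_measurable:
  assumes "process M X" "I \<subseteq> {0..}"
  shows "(\<lambda>\<omega>. \<lambda>t\<in>I. X t \<omega>) \<in> completion M \<rightarrow>\<^sub>M Pi\<^sub>M I (\<lambda>_. borel)"
  using assms by (intro measurable_restrict) (auto simp: process_def)

text \<open>
  The paths are cadlag and start at zero only almost surely; on the completed space the
  exceptional null set does not affect measurability.
\<close>

lemma process_averaged_random_scaling:
  assumes Z: "process M Z" "sample_paths_in M cadlag_paths Z" and Z0: "AE \<omega> in M. Z 0 \<omega> = 0"
  shows "process M (averaged_random_scaling Z)"
  unfolding process_def
proof (intro allI impI)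
  fix u :: real assume u: "0 \<le> u"
  have "(\<lambda>\<omega>. energy_functional u (\<lambda>t\<in>{0..u}. Z t \<omega>)) \<in> borel_measurable (completion M)"
    by (intro energy_functional_measurable u path_map_measurable Z) auto
  moreover have "AE \<omega> in M. energy_functional u (\<lambda>t\<in>{0..u}. Z t \<omega>) = averaged_random_scaling Z u \<omega>"
    using Z(2)[unfolded sample_paths_in_def] Z0
    by eventually_elim (simp add: averaged_random_scaling_eq_functional u)
  ultimately show "averaged_random_scaling Z u \<in> borel_measurable (completion M)"
    by (intro measurable_completion_cong_AE[of _ M borel "averaged_random_scaling Z u"]) auto
qed

text \<open>
  The joint law of a process and its averaged random scaling is the image of the law of the
  process, so it inherits every scaling relation of that law.
\<close>

definition adjoin_energy :: "(real \<Rightarrow> real) \<Rightarrow> real \<Rightarrow> real \<times> real" where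
  "adjoin_energy x = (\<lambda>t\<in>{0..}. (x t, energy_functional t (restrict x {0..t})))"

lemma adjoin_energy_measurable:
  "adjoin_energy \<in> Pi\<^sub>M {0..} (\<lambda>_. borel) \<rightarrow>\<^sub>M Pi\<^sub>M {0..} (\<lambda>_. borel)"
proof -
  have "(\<lambda>x. (x t, energy_functional t (restrict x {0..t})))
      \<in> borel_measurable (Pi\<^sub>M {0..} (\<lambda>_. borel :: real measure))" if t: "t \<in> {0..}" for t
    using t
    by (intro borel_measurable_Pair measurable_component_singleton energy_functional_measurable
        measurable_restrict_subset) auto
  then show ?thesis unfolding adjoin_energy_def[abs_def] by (rule measurable_restrict)
qed

lemma path_law_with_energy:
  assumes X: "process N X" "sample_paths_in N cadlag_paths X" and X0: "AE \<omega> in N. X 0 \<omega> = 0"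
    and V: "AE \<omega> in N. \<forall>t\<ge>0. V t \<omega> = averaged_random_scaling X t \<omega>"
  shows "path_law N (\<lambda>t \<omega>. (X t \<omega>, V t \<omega>)) =
    distr (path_law N X) (Pi\<^sub>M {0..} (\<lambda>_. borel)) adjoin_energy"
proof -
  have path: "(\<lambda>\<omega>. \<lambda>t\<in>{0..}. X t \<omega>) \<in> completion N \<rightarrow>\<^sub>M Pi\<^sub>M {0..} (\<lambda>_. borel)"
    by (rule path_map_measurable[OF X(1)]) simp
  have V_meas: "V t \<in> borel_measurable (completion N)" if "0 \<le> t" for t
  proof (rule measurable_completion_cong_AE)
    show "averaged_random_scaling X t \<in> borel_measurable (completion N)"
      using process_averaged_random_scaling[OF X X0] that by (simp add: process_def)
    show "AE \<omega> in N. averaged_random_scaling X t \<omega> = V t \<omega>"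
      using V by eventually_elim (use that in simp)
  qed simp
  have "distr (path_law N X) (Pi\<^sub>M {0..} (\<lambda>_. borel)) adjoin_energy =
      distr (completion N) (Pi\<^sub>M {0..} (\<lambda>_. borel)) (adjoin_energy \<circ> (\<lambda>\<omega>. \<lambda>t\<in>{0..}. X t \<omega>))"
    unfolding path_law_def by (rule distr_distr[OF adjoin_energy_measurable path])
  also have "\<dots> = distr (completion N) (Pi\<^sub>M {0..} (\<lambda>_. borel)) (\<lambda>\<omega>. \<lambda>t\<in>{0..}. (X t \<omega>, V t \<omega>))"
  proof (rule distr_cong_AE[OF refl refl])
    show "AE \<omega> in completion N. (adjoin_energy \<circ> (\<lambda>\<omega>. \<lambda>t\<in>{0..}. X t \<omega>)) \<omega> =
        (\<lambda>t\<in>{0..}. (X t \<omega>, V t \<omega>))"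
    proof (rule AE_completion)
      show "AE \<omega> in N. (adjoin_energy \<circ> (\<lambda>\<omega>. \<lambda>t\<in>{0..}. X t \<omega>)) \<omega> = (\<lambda>t\<in>{0..}. (X t \<omega>, V t \<omega>))"
        using X(2)[unfolded sample_paths_in_def] X0 V
      proof eventually_elim
        case (elim \<omega>)
        have "{0..} \<inter> {0..t} = {0..t}" for t :: real by auto
        with elim show ?case
          by (auto simp: adjoin_energy_def fun_eq_iff averaged_random_scaling_eq_functional)
      qed
    qed
    show "adjoin_energy \<circ> (\<lambda>\<omega>. \<lambda>t\<in>{0..}. X t \<omega>) \<in> completion N \<rightarrow>\<^sub>M Pi\<^sub>M {0..} (\<lambda>_. borel)"
      by (rule measurable_comp[OF path adjoin_energy_measurable])
    show "(\<lambda>\<omega>. \<lambda>t\<in>{0..}. (X t \<omega>, V t \<omega>)) \<in> completion N \<rightarrow>\<^sub>M Pi\<^sub>M {0..} (\<lambda>_. borel)"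
      using X(1) V_meas
      by (intro measurable_restrict borel_measurable_Pair) (auto simp: process_def)
  qed
  finally show ?thesis by (simp add: path_law_def)
qed

section \<open>Consequences of self-similarity\<close>

lemma cadlag_time_scale:
  assumes x: "x \<in> cadlag_paths" and a: "0 < a"
  shows "(\<lambda>t. x (a * t)) \<in> cadlag_paths"
proof -
  have right: "filterlim ((*) a) (at_right (a * t)) (at_right t)" for t :: real
    using filtermap_times_pos_at_right[OF a, of t] by (simp add: filterlim_def)
  have left: "filterlim ((*) a) (at_left (a * t)) (at_left t)" for t :: real
    unfolding filterlim_at
  proof
    show "\<forall>\<^sub>F s in at_left t. a * s \<in> {..<a * t} \<and> a * s \<noteq> a * t"
      using a by (simp add: eventually_at_filter)
    show "((*) a \<longlongrightarrow> a * t) (at_left t)" by (intro tendsto_intros)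
  qed
  have "((\<lambda>t. x (a * t)) \<longlongrightarrow> x (a * t)) (at_right t)" if "0 \<le> t" for t
    using filterlim_compose[OF cadlag_tendsto_right[OF x, of "a * t"] right] a that by simp
  moreover have "((\<lambda>t. x (a * t)) \<longlongrightarrow> left_limit x (a * t)) (at_left t)" if "0 < t" for t
    using filterlim_compose[OF cadlag_tendsto_left_limit[OF x, of "a * t"] left] a that by simp
  ultimately show ?thesis unfolding cadlag_paths_def by blast
qed

lemma cadlag_space_scale:
  assumes x: "x \<in> cadlag_paths"
  shows "(\<lambda>t. c * x t) \<in> cadlag_paths"
proof -
  have "((\<lambda>t. c * x t) \<longlongrightarrow> c * x t) (at_right t)" if "0 \<le> t" for t
    by (intro tendsto_intros cadlag_tendsto_right x that)
  moreover have "((\<lambda>t. c * x t) \<longlongrightarrow> c * left_limit x t) (at_left t)" if "0 < t" for t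
    by (intro tendsto_intros cadlag_tendsto_left_limit x that)
  ultimately show ?thesis unfolding cadlag_paths_def by blast
qed

lemma process_time_scale: "process M X \<Longrightarrow> 0 < a \<Longrightarrow> process M (\<lambda>t. X (a * t))"
  by (simp add: process_def)

lemma process_space_scale: "process M X \<Longrightarrow> process M (\<lambda>t \<omega>. c * X t \<omega>)"
  unfolding process_def by (intro allI impI borel_measurable_times borel_measurable_const) simp

text \<open>
  Self-similarity gives \<open>Y 0\<close> the law of \<open>Y 0 / n\<close> for every positive \<open>n\<close>, so that the expectations of
  the minimum of 1 and the absolute value of either coincide; the latter tend to zero.
\<close>

lemma self_similar_zero_start:
  assumes N: "prob_space N" and Y: "process N Y" and h: "0 < h"
    and scaling: "\<And>a. 0 < a \<Longrightarrow>
      path_law N (\<lambda>t. Y (a * t)) = path_law N (\<lambda>t \<omega>. a powr h * Y t \<omega>)"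
  shows "AE \<omega> in N. Y 0 \<omega> = 0"
proof -
  interpret completion: prob_space "completion N"
    by (rule prob_space.prob_space_completion[OF N])
  have Y0 [measurable]: "Y 0 \<in> borel_measurable (completion N)"
    using Y by (simp add: process_def)
  have law: "distr (path_law N X) borel (\<lambda>x. x 0) = distr (completion N) borel (X 0)"
    if "process N X" for X :: "real \<Rightarrow> 'a \<Rightarrow> real"
    unfolding path_law_def
    by (subst distr_distr[OF measurable_component_singleton path_map_measurable[OF that]])
      (simp_all add: o_def)
  define g :: "real \<Rightarrow> real" where "g y = min 1 \<bar>y\<bar>" for y
  have [measurable]: "g \<in> borel_measurable borel" unfolding g_def[abs_def] by measurable
  have eq: "(\<integral>\<omega>. g (Y 0 \<omega>) \<partial>completion N) = (\<integral>\<omega>. g (Y 0 \<omega> / real (Suc n)) \<partial>completion N)" for n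
  proof -
    \<comment> \<open>The scale whose power \<open>h\<close> is \<open>1 / Suc n\<close>.\<close>
    define a where "a = (1 / real (Suc n)) powr (1 / h)"
    have a: "0 < a" "a powr h = 1 / real (Suc n)"
      using h by (simp_all add: a_def powr_powr)
    have p: "process N (\<lambda>t. Y (a * t))" "process N (\<lambda>t \<omega>. a powr h * Y t \<omega>)"
      by (intro process_time_scale process_space_scale Y a(1))+
    have "distr (completion N) borel (Y 0) = distr (completion N) borel (\<lambda>\<omega>. a powr h * Y 0 \<omega>)"
      using law[OF p(1)] law[OF p(2)] by (simp add: scaling[OF a(1)])
    then have "(\<integral>y. g y \<partial>distr (completion N) borel (Y 0)) =
        (\<integral>y. g y \<partial>distr (completion N) borel (\<lambda>\<omega>. a powr h * Y 0 \<omega>))"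
      by simp
    then show ?thesis by (simp add: integral_distr a(2))
  qed
  have "(\<lambda>n. \<integral>\<omega>. g (Y 0 \<omega> / real (Suc n)) \<partial>completion N) \<longlonglongrightarrow> (\<integral>\<omega>. 0 \<partial>completion N)"
  proof (rule integral_dominated_convergence[where w = "\<lambda>_. 1"])
    have "(\<lambda>n. g (y / real (Suc n))) \<longlonglongrightarrow> 0" for y
    proof -
      have "(\<lambda>n. y * inverse (real (Suc n))) \<longlonglongrightarrow> y * 0"
        by (intro tendsto_mult tendsto_const LIMSEQ_inverse_real_of_nat)
      then have "(\<lambda>n. min 1 \<bar>y / real (Suc n)\<bar>) \<longlonglongrightarrow> min 1 \<bar>0\<bar>"
        by (intro tendsto_min tendsto_const tendsto_rabs) (simp add: divide_inverse)
      then show ?thesis by (simp add: g_def)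
    qed
    then show "AE \<omega> in completion N. (\<lambda>n. g (Y 0 \<omega> / real (Suc n))) \<longlonglongrightarrow> 0" by simp
  qed (auto simp: g_def)
  then have "(\<integral>\<omega>. g (Y 0 \<omega>) \<partial>completion N) = 0"
    unfolding eq[symmetric] using LIMSEQ_const_iff by fastforce
  moreover have "integrable (completion N) (\<lambda>\<omega>. g (Y 0 \<omega>))"
    by (rule completion.integrable_const_bound[of _ 1]) (auto simp: g_def)
  ultimately have "AE \<omega> in completion N. g (Y 0 \<omega>) = 0"
    by (subst (asm) integral_nonneg_eq_0_iff_AE) (auto simp: g_def)
  then have "AE \<omega> in completion N. Y 0 \<omega> = 0"
    by eventually_elim (simp add: g_def min_def split: if_splits)
  then show ?thesis by (simp add: AE_completion_iff)
qed

text \<open>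
  Averaged random scaling commutes with linear time changes and is quadratic under multiplication of the
  path, so the two laws are those of processes with equal law, each together with its own averaged
  random scaling.
\<close>

lemma joint_self_similarity:
  assumes Y: "process N Y" "sample_paths_in N cadlag_paths Y" and Y0: "AE \<omega> in N. Y 0 \<omega> = 0"
    and a: "0 < a"
    and scaling: "path_law N (\<lambda>t. Y (a * t)) = path_law N (\<lambda>t \<omega>. a powr h * Y t \<omega>)"
  shows "path_law N (\<lambda>t \<omega>. (Y (a * t) \<omega>, averaged_random_scaling Y (a * t) \<omega>)) =
    path_law N (\<lambda>t \<omega>. (a powr h * Y t \<omega>, a powr (2 * h) * averaged_random_scaling Y t \<omega>))"
proof -
  have "path_law N (\<lambda>t \<omega>. (Y (a * t) \<omega>, averaged_random_scaling Y (a * t) \<omega>)) =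
      distr (path_law N (\<lambda>t. Y (a * t))) (Pi\<^sub>M {0..} (\<lambda>_. borel)) adjoin_energy"
  proof (rule path_law_with_energy)
    show "process N (\<lambda>t. Y (a * t))" by (rule process_time_scale[OF Y(1) a])
    show "sample_paths_in N cadlag_paths (\<lambda>t. Y (a * t))"
      using Y(2) unfolding sample_paths_in_def
      by eventually_elim (rule cadlag_time_scale[OF _ a])
    show "AE \<omega> in N. Y (a * 0) \<omega> = 0" using Y0 by simp
    show "AE \<omega> in N. \<forall>t\<ge>0. averaged_random_scaling Y (a * t) \<omega> =
        averaged_random_scaling (\<lambda>t. Y (a * t)) t \<omega>"
      using Y0
    proof eventually_elim
      case (elim \<omega>)
      have "mean_bridge_energy (\<lambda>t. Y (a * t) \<omega>) t = mean_bridge_energy (\<lambda>t. Y t \<omega>) (a * t)" for t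
        using mean_bridge_energy_rescale[of 1 "\<lambda>t. Y t \<omega>" "1 / a" 0 t] by (simp add: mult.commute)
      then show ?case using elim a by (simp add: averaged_random_scaling_eq max_absorb2)
    qed
  qed
  also have "\<dots> = distr (path_law N (\<lambda>t \<omega>. a powr h * Y t \<omega>)) (Pi\<^sub>M {0..} (\<lambda>_. borel)) adjoin_energy"
    by (simp only: scaling)
  also have "\<dots> = path_law N (\<lambda>t \<omega>. (a powr h * Y t \<omega>, a powr (2 * h) * averaged_random_scaling Y t \<omega>))"
  proof (rule path_law_with_energy[symmetric])
    show "process N (\<lambda>t \<omega>. a powr h * Y t \<omega>)" by (rule process_space_scale[OF Y(1)])
    show "sample_paths_in N cadlag_paths (\<lambda>t \<omega>. a powr h * Y t \<omega>)"
      using Y(2) unfolding sample_paths_in_def by eventually_elim (rule cadlag_space_scale)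
    show "AE \<omega> in N. a powr h * Y 0 \<omega> = 0" using Y0 by eventually_elim simp
    have square: "a powr (2 * h) = (a powr h)\<^sup>2"
      by (simp add: power2_eq_square flip: powr_add)
    show "AE \<omega> in N. \<forall>t\<ge>0. a powr (2 * h) * averaged_random_scaling Y t \<omega> =
        averaged_random_scaling (\<lambda>t \<omega>. a powr h * Y t \<omega>) t \<omega>"
      using Y0
    proof eventually_elim
      case (elim \<omega>)
      have "mean_bridge_energy (\<lambda>t. a powr h * Y t \<omega>) t =
          (a powr h)\<^sup>2 * mean_bridge_energy (\<lambda>t. Y t \<omega>) t" for t
        using mean_bridge_energy_rescale[of "a powr h" "\<lambda>t. Y t \<omega>" 1 0 t] by simp
      then show ?case using elim by (simp add: averaged_random_scaling_eq square)
    qed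
  qed
  finally show ?thesis .
qed

text \<open>
  At any single time, positivity follows from positivity at time 1 by self-similarity; it then
  propagates to all later times simultaneously, and arbitrarily small times suffice.
\<close>

lemma averaged_random_scaling_pos:
  assumes Y: "process N Y" "sample_paths_in N cadlag_paths Y" and Y0: "AE \<omega> in N. Y 0 \<omega> = 0"
    and scaling: "\<And>a. 0 < a \<Longrightarrow>
      path_law N (\<lambda>t. Y (a * t)) = path_law N (\<lambda>t \<omega>. a powr h * Y t \<omega>)"
    and pos: "AE \<omega> in N. 0 < averaged_random_scaling Y 1 \<omega>"
  shows "AE \<omega> in N. \<forall>t>0. 0 < averaged_random_scaling Y t \<omega>"
proof -
  have V: "process N (averaged_random_scaling Y)"
    by (rule process_averaged_random_scaling[OF Y Y0])
  have "AE \<omega> in N. 0 < averaged_random_scaling Y a \<omega>" if a: "0 < a" for a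
  proof -
    let ?P = "Pi\<^sub>M {0::real..} (\<lambda>_. borel :: (real \<times> real) measure)"
    let ?X = "\<lambda>t \<omega>. (Y (a * t) \<omega>, averaged_random_scaling Y (a * t) \<omega>)"
    let ?W = "\<lambda>t \<omega>. (a powr h * Y t \<omega>, a powr (2 * h) * averaged_random_scaling Y t \<omega>)"
    have comp: "(\<lambda>x. x 1) \<in> ?P \<rightarrow>\<^sub>M borel" by (rule measurable_component_singleton) simp
    have "(\<lambda>x. snd (x 1)) \<in> ?P \<rightarrow>\<^sub>M borel"
      using measurable_compose[OF comp, of snd borel] by (simp add: borel_prod[symmetric])
    then have [measurable]: "{x \<in> space ?P. 0 < snd (x 1)} \<in> sets ?P" by measurable
    have AE_law: "(AE x in path_law N X. 0 < snd (x 1)) \<longleftrightarrow> (AE \<omega> in N. 0 < snd (X 1 \<omega>))"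
      if "\<And>t. 0 \<le> t \<Longrightarrow> X t \<in> borel_measurable (completion N)" for X :: "real \<Rightarrow> 'a \<Rightarrow> real \<times> real"
    proof -
      have "(\<lambda>\<omega>. \<lambda>t\<in>{0..}. X t \<omega>) \<in> completion N \<rightarrow>\<^sub>M ?P"
        using that by (intro measurable_restrict) simp
      then show ?thesis unfolding path_law_def by (subst AE_distr_iff) (simp_all add: AE_completion_iff)
    qed
    have meas: "?X t \<in> borel_measurable (completion N)" "?W t \<in> borel_measurable (completion N)"
      if "0 \<le> t" for t
      by (intro borel_measurable_Pair that
          process_time_scale[OF Y(1) a, unfolded process_def, rule_format]
          process_time_scale[OF V a, unfolded process_def, rule_format]
          process_space_scale[OF Y(1), unfolded process_def, rule_format]
          process_space_scale[OF V, unfolded process_def, rule_format])+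
    have "AE \<omega> in N. 0 < snd (?W 1 \<omega>)"
      using pos by eventually_elim (use a in simp)
    then have "AE x in path_law N ?W. 0 < snd (x 1)" using AE_law[OF meas(2)] by simp
    moreover have "path_law N ?X = path_law N ?W"
      by (rule joint_self_similarity[OF Y Y0 a scaling[OF a]])
    ultimately have "AE x in path_law N ?X. 0 < snd (x 1)" by (simp only:)
    then show ?thesis using AE_law[OF meas(1)] by simp
  qed
  then have "AE \<omega> in N. \<forall>n. 0 < averaged_random_scaling Y (1 / real (Suc n)) \<omega>"
    by (simp add: AE_all_countable)
  then show ?thesis
    using Y(2)[unfolded sample_paths_in_def] Y0
  proof eventually_elim
    case (elim \<omega>)
    show ?case
    proof (intro allI impI)
      fix t :: real assume "0 < t"
      then obtain n where n: "1 / real (Suc n) < t" using nat_approx_posE by blast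
      have "0 < mean_bridge_energy (\<lambda>t. Y t \<omega>) (1 / real (Suc n))"
        using elim(1,3) by (simp add: averaged_random_scaling_eq max_absorb2)
      then have "0 < mean_bridge_energy (\<lambda>t. Y t \<omega>) t"
        by (rule mean_bridge_energy_pos_mono[OF elim(2) _ less_imp_le[OF n], rotated]) simp
      then show "0 < averaged_random_scaling Y t \<omega>"
        using elim(3) \<open>0 < t\<close> by (simp add: averaged_random_scaling_eq max_absorb2)
    qed
  qed
qed

section \<open>The filtration is not enlarged\<close>

lemma augmented_filtration_adjoin:
  assumes adapted: "\<And>u B. 0 \<le> u \<Longrightarrow> B \<in> sets borel \<Longrightarrow>
      V u -` B \<inter> space N \<in> sigma_sets (space N)
        ({Y r -` A \<inter> space N | r A. 0 \<le> r \<and> r \<le> u \<and> A \<in> sets borel} \<union> null_sets (completion N))"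
  shows "augmented_filtration N {Y, V} = augmented_filtration N {Y}"
proof -
  define G where "G \<Y> s = {X u -` B \<inter> space N | X u B. X \<in> \<Y> \<and> 0 \<le> u \<and> u \<le> s \<and> B \<in> sets borel}
      \<union> null_sets (completion N)" for \<Y> :: "(real \<Rightarrow> 'a \<Rightarrow> real) set" and s
  have "sigma_sets (space N) (G {Y, V} s) = sigma_sets (space N) (G {Y} s)" for s
  proof (rule sigma_sets_eqI)
    fix E assume E: "E \<in> G {Y, V} s"
    show "E \<in> sigma_sets (space N) (G {Y} s)"
    proof (cases "E \<in> G {Y} s")
      case True then show ?thesis by (rule sigma_sets.Basic)
    next
      case False
      with E obtain u B where u: "0 \<le> u" "u \<le> s" "B \<in> sets borel" and E_eq: "E = V u -` B \<inter> space N"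
        unfolding G_def by auto
      have "{Y r -` A \<inter> space N | r A. 0 \<le> r \<and> r \<le> u \<and> A \<in> sets borel} \<union> null_sets (completion N)
          \<subseteq> G {Y} s"
        using u(2) unfolding G_def by fastforce
      then show ?thesis
        unfolding E_eq using adapted[OF u(1,3)] sigma_sets_mono' by blast
    qed
  next
    fix E assume "E \<in> G {Y} s"
    then have "E \<in> G {Y, V} s" unfolding G_def by blast
    then show "E \<in> sigma_sets (space N) (G {Y, V} s)" by (rule sigma_sets.Basic)
  qed
  then show ?thesis unfolding augmented_filtration_def G_def by simp
qed

text \<open>
  Off a null set, averaged random scaling at time \<open>u\<close> is a measurable functional of the path up to
  \<open>u\<close>, and the generators contain all null sets.
\<close>

lemma averaged_random_scaling_adapted:
  assumes Y: "sample_paths_in N cadlag_paths Y" and Y0: "AE \<omega> in N. Y 0 \<omega> = 0"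
    and u: "0 \<le> u" and B: "B \<in> sets borel"
  shows "averaged_random_scaling Y u -` B \<inter> space N \<in> sigma_sets (space N)
    ({Y r -` A \<inter> space N | r A. 0 \<le> r \<and> r \<le> u \<and> A \<in> sets borel} \<union> null_sets (completion N))"
proof -
  let ?V = "averaged_random_scaling Y u"
  define G where "G = {Y r -` A \<inter> space N | r A. 0 \<le> r \<and> r \<le> u \<and> A \<in> sets borel}
      \<union> null_sets (completion N)"
  define S where "S = sigma (space N) G"
  have G: "G \<subseteq> Pow (space N)"
    using sets.sets_into_space[of _ "completion N"] by (fastforce simp: G_def null_sets_def)
  have space_S: "space S = space N" and sets_S: "sets S = sigma_sets (space N) G"
    using G by (simp_all add: S_def)
  have Y_meas: "Y r \<in> borel_measurable S" if "r \<in> {0..u}" for r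
  proof (rule measurableI)
    fix A :: "real set" assume "A \<in> sets borel"
    then have "Y r -` A \<inter> space N \<in> G" using that unfolding G_def by auto
    then show "Y r -` A \<inter> space S \<in> sets S" by (simp add: space_S sets_S sigma_sets.Basic)
  qed simp
  define f where "f \<omega> = energy_functional u (\<lambda>t\<in>{0..u}. Y t \<omega>)" for \<omega>
  have f: "f \<in> borel_measurable S"
    unfolding f_def[abs_def] by (intro energy_functional_measurable u measurable_restrict Y_meas)
  have null_in_S: "E \<in> sets S" if "E \<in> null_sets (completion N)" for E
    using that by (simp add: sets_S G_def sigma_sets.Basic)
  define E where "E = {\<omega> \<in> space N. ?V \<omega> \<noteq> f \<omega>}"
  have AE_eq: "AE \<omega> in N. ?V \<omega> = f \<omega>"
    using Y[unfolded sample_paths_in_def] Y0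
    by eventually_elim (simp add: f_def averaged_random_scaling_eq_functional u)
  then have E: "E \<in> null_sets (completion N)"
    using AE_completion[OF AE_eq] completion.AE_iff_null_sets[of "\<lambda>\<omega>. ?V \<omega> = f \<omega>" N]
    by (simp add: E_def)
  have "?V -` B \<inter> E \<in> null_sets (completion N)"
    by (rule null_sets_completion_subset[OF _ E]) simp
  then have "(f -` B \<inter> space S - E) \<union> (?V -` B \<inter> E) \<in> sets S"
    using E by (intro sets.Un sets.Diff null_in_S measurable_sets[OF f B])
  also have "(f -` B \<inter> space S - E) \<union> (?V -` B \<inter> E) = ?V -` B \<inter> space N"
    by (auto simp: E_def space_S)
  finally show ?thesis by (simp add: sets_S G_def)
qed

section \<open>Random scaling satisfies the functional limit condition\<close>

lemma continuous_on_averaged_random_scaling: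
  assumes "(\<lambda>t. Z t \<omega>) \<in> cadlag_paths" "Z 0 \<omega> = 0"
  shows "continuous_on {0..} (\<lambda>t. averaged_random_scaling Z t \<omega>)"
  using continuous_on_mean_bridge_energy[OF assms(1)]
  by (rule continuous_on_eq) (simp add: averaged_random_scaling_eq[of Z, OF assms(2)] max_absorb2)

lemma averaged_random_scaling_nonneg_cadlag:
  assumes "(\<lambda>t. Z t \<omega>) \<in> cadlag_paths" "Z 0 \<omega> = 0"
  shows "(\<lambda>t. averaged_random_scaling Z t \<omega>) \<in> nonneg_cadlag_paths"
  unfolding nonneg_cadlag_paths_def
  using continuous_on_imp_cadlag[OF continuous_on_averaged_random_scaling[of Z, OF assms]]
  by (simp add: averaged_random_scaling_eq[of Z, OF assms(2)] mean_bridge_energy_nonneg)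

lemma averaged_random_scaling_sublinear:
  assumes Z: "(\<lambda>t. Z t \<omega>) \<in> cadlag_paths" "Z 0 \<omega> = 0"
    and lim: "((\<lambda>t. (Z t \<omega> - \<mu> * t) / t) \<longlongrightarrow> 0) at_top"
  shows "((\<lambda>t. averaged_random_scaling Z t \<omega> / t\<^sup>2) \<longlongrightarrow> 0) at_top"
proof -
  have eq: "mean_bridge_energy (\<lambda>t. Z t \<omega> - \<mu> * t) t = mean_bridge_energy (\<lambda>t. Z t \<omega>) t" for t
    using mean_bridge_energy_rescale[of 1 "\<lambda>t. Z t \<omega>" 1 \<mu> t] by (simp add: mult.commute)
  have "((\<lambda>t. mean_bridge_energy (\<lambda>t. Z t \<omega> - \<mu> * t) t / t\<^sup>2) \<longlongrightarrow> 0) at_top"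
  proof (rule mean_bridge_energy_sublinear[OF lim])
    fix T
    obtain K where K: "\<And>s. 0 \<le> s \<Longrightarrow> s \<le> T \<Longrightarrow> \<bar>Z s \<omega>\<bar> \<le> K" using cadlag_bounded[OF Z(1)] by blast
    have "\<bar>Z s \<omega> - \<mu> * s\<bar> \<le> K + \<bar>\<mu>\<bar> * T" if s: "0 \<le> s" "s \<le> T" for s
    proof -
      have "\<bar>\<mu> * s\<bar> \<le> \<bar>\<mu>\<bar> * T" unfolding abs_mult using s by (intro mult_left_mono) auto
      then show ?thesis using K[OF s] by linarith
    qed
    then show "\<exists>K. \<forall>s. 0 \<le> s \<and> s \<le> T \<longrightarrow> \<bar>Z s \<omega> - \<mu> * s\<bar> \<le> K" by blast
  qed
  then have lim': "((\<lambda>t. mean_bridge_energy (\<lambda>t. Z t \<omega>) t / t\<^sup>2) \<longlongrightarrow> 0) at_top" by (simp add: eq)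
  have "\<forall>\<^sub>F t in at_top. mean_bridge_energy (\<lambda>t. Z t \<omega>) t / t\<^sup>2 = averaged_random_scaling Z t \<omega> / t\<^sup>2"
    using eventually_ge_at_top[of 0]
    by eventually_elim (simp add: averaged_random_scaling_eq[of Z, OF Z(2)] max_absorb2)
  then show ?thesis by (rule Lim_transform_eventually[OF lim'])
qed

theorem theorem4p5:
  fixes M :: "'a measure" and N :: "'b measure"
    and Z1 :: "real \<Rightarrow> 'a \<Rightarrow> real" and Y1 :: "real \<Rightarrow> 'b \<Rightarrow> real"
    and \<mu> h :: real and l :: "real \<Rightarrow> real"
  assumes "prob_space M" and "prob_space N"
    and "marginal_limit_condition M Z1 \<mu> h l N Y1"
    and "AE \<omega> in N. averaged_random_scaling Y1 1 \<omega> > 0"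
  shows "functional_weak_limit M Z1 (averaged_random_scaling Z1) \<mu> h l
           N Y1 (averaged_random_scaling Y1) \<and>
         (AE \<omega> in N. continuous_on {0..} (\<lambda>t. averaged_random_scaling Y1 t \<omega>)) \<and>
         functional_limit_condition M Z1 (averaged_random_scaling Z1) \<mu> h l
           N Y1 (averaged_random_scaling Y1)"
proof -
  note cond = assms(3)[unfolded marginal_limit_condition_def]
  from cond have Z: "process M Z1" "sample_paths_in M cadlag_paths Z1"
    and Z0: "AE \<omega> in M. Z1 0 \<omega> = 0" and h: "0 < h" "h < 1"
    and l: "\<forall>\<^sub>F x in at_top. 0 < l x" "slowly_varying l"
    and Y: "process N Y1" "sample_paths_in N cadlag_paths Y1"
    and conv: "converges_weakly m2_topology M (\<lambda>\<epsilon>. rescaled_centred \<mu> h l \<epsilon> Z1)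
      N (\<lambda>\<omega> t. Y1 t \<omega>) (at_right 0)"
    and drift: "AE \<omega> in M. ((\<lambda>t. (Z1 t \<omega> - \<mu> * t) / t) \<longlongrightarrow> 0) at_top"
    and scaling: "\<And>a. 0 < a \<Longrightarrow>
      path_law N (\<lambda>t. Y1 (a * t)) = path_law N (\<lambda>t \<omega>. a powr h * Y1 t \<omega>)"
    and qlc: "quasi_left_continuous N (augmented_filtration N {Y1}) Y1"
    by blast+
  have Y0: "AE \<omega> in N. Y1 0 \<omega> = 0"
    by (rule self_similar_zero_start[OF assms(2) Y(1) h(1) scaling])
  have weak: "functional_weak_limit M Z1 (averaged_random_scaling Z1) \<mu> h l
      N Y1 (averaged_random_scaling Y1)"
    by (rule functional_weak_limit_averaged_random_scaling[OF Z0 Y0 l(1) conv])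
  have cont: "AE \<omega> in N. continuous_on {0..} (\<lambda>t. averaged_random_scaling Y1 t \<omega>)"
    using Y(2)[unfolded sample_paths_in_def] Y0
    by eventually_elim (rule continuous_on_averaged_random_scaling)
  have Z2_paths: "sample_paths_in M nonneg_cadlag_paths (averaged_random_scaling Z1)"
    unfolding sample_paths_in_def using Z(2)[unfolded sample_paths_in_def] Z0
    by eventually_elim (rule averaged_random_scaling_nonneg_cadlag)
  have Y2_paths: "sample_paths_in N nonneg_cadlag_paths (averaged_random_scaling Y1)"
    unfolding sample_paths_in_def using Y(2)[unfolded sample_paths_in_def] Y0
    by eventually_elim (rule averaged_random_scaling_nonneg_cadlag)
  have Z2_growth: "AE \<omega> in M. ((\<lambda>t. averaged_random_scaling Z1 t \<omega> / t\<^sup>2) \<longlongrightarrow> 0) at_top"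
    using Z(2)[unfolded sample_paths_in_def] Z0 drift
    by eventually_elim (rule averaged_random_scaling_sublinear)
  have qlc2: "quasi_left_continuous N (augmented_filtration N {Y1, averaged_random_scaling Y1}) Y1"
  proof -
    have "augmented_filtration N {Y1, averaged_random_scaling Y1} = augmented_filtration N {Y1}"
      by (rule augmented_filtration_adjoin, rule averaged_random_scaling_adapted[OF Y(2) Y0])
    then show ?thesis using qlc by (simp only:)
  qed
  have Y2_pos: "AE \<omega> in N. \<forall>t>0. 0 < averaged_random_scaling Y1 t \<omega>"
    by (rule averaged_random_scaling_pos[OF Y Y0 scaling assms(4)])
  have Y2_jump: "AE \<omega> in N. \<forall>t>0. 0 \<le> jump (\<lambda>s. averaged_random_scaling Y1 s \<omega>) t"
    using cont by eventually_elim (simp add: continuous_on_imp_jump_zero)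
  have "functional_limit_condition M Z1 (averaged_random_scaling Z1) \<mu> h l
      N Y1 (averaged_random_scaling Y1)"
    unfolding functional_limit_condition_def
    by (intro conjI allI impI Z Z0 l Y weak h drift Z2_paths Y2_paths Z2_growth qlc2 Y2_pos Y2_jump
        process_averaged_random_scaling[OF Z Z0] process_averaged_random_scaling[OF Y Y0]
        joint_self_similarity[OF Y Y0 _ scaling])
  with weak cont show ?thesis by blast
qed

end
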